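(* Let $\theta<0$ and $\xi\in(0,1)$. Put $\gamma=\frac{1-\xi}{\xi}$, $u=-\sqrt{\xi(1-\xi)}$, $\lambda=\frac{-u}{\arctan_{-\theta}(\gamma^{-1/2})}$, $z_0=\frac1\lambda$ and $g(z)=\cos_{-\theta}(uz)+\gamma^{1/2}\sin_{-\theta}(uz)$. Then, as $n\to\infty$, $$p_n^{\xi}(\theta)\sim c_2(\theta,\xi)\,\lambda^{n+1},$$ where $c_2(\theta,\xi)=c(\theta,\lambda,\xi)\,\lambda$ and $$c(\theta,\lambda,\xi)=\lim_{z\to z_0}(z_0-z)\,\frac{\cos_{-\theta}(uz)-\gamma^{-1/2}\sin_{-\theta}(uz)}{g(z)}=-\frac{\cos_{-\theta}(uz_0)-\gamma^{-1/2}\sin_{-\theta}(uz_0)}{g'(z_0)}.$$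
   Context: For $\xi\in[0,1]$ let $\phi_\xi(x)=\xi e^{x}$ for $x<0$ and $\phi_\xi(x)=(1-\xi)e^{-x}$ for $x>0$, and let $(X_i)_{i\ge0}$ be i.i.d. with density $\phi_\xi$. Put $p_0^{\xi}(\theta)=1$ and $p_n^{\xi}(\theta)=\mathbb{P}(X_2>\theta X_1,X_3>\theta X_2,\dots,X_{n+1}>\theta X_n)$ for $n\ge1$. $a_n\sim b_n$ means $a_n/b_n\to1$. $q$-notation. For $q>0$, $q\ne1$: $[k]_q=\frac{1-q^k}{1-q}$, $[n]_q!=\prod_{k=1}^n[k]_q$, and $[n]_1!=n!$. Define $e_q(z)=\sum_{n\ge0}\frac{z^n}{[n]_q!}$, $\cos_q(z)=\sum_{n\ge0}\frac{(-1)^nz^{2n}}{[2n]_q!}$, $\sin_q(z)=\sum_{n\ge0}\frac{(-1)^nz^{2n+1}}{[2n+1]_q!}$. For $q\ge1$ these are entire. For $0<q<1$ the series converge for $|z|<1/(1-q)$, and the same symbols denote the meromorphic continuations to $\mathbb{C}$, given by $e_q(z)=\prod_{n\ge0}\frac{1}{1-z(1-q)q^n}$, $\cos_q(z)=\frac{e_q(iz)+e_q(-iz)}{2}$, $\sin_q(z)=\frac{e_q(iz)-e_q(-iz)}{2i}$. For $q>0$, $z_c(q)$ is the smallest positive real zero of $\cos_q$; the function $\tan_q=\sin_q/\cos_q:[0,z_c(q))\to[0,\infty)$ is a strictly increasing bijection, and $\arctan_q$ denotes its inverse. *)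

theory Defs
  imports "HOL-Probability.Probability"
begin

section \<open>$q$-trigonometric functions\<close>

definition qnum :: "real \<Rightarrow> nat \<Rightarrow> real" where
  "qnum q k = (1 - q ^ k) / (1 - q)"

definition qfact :: "real \<Rightarrow> nat \<Rightarrow> real" where
  "qfact q n = (if q = 1 then fact n else (\<Prod>k=1..n. qnum q k))"

text \<open>
  For \<open>0 < q < 1\<close> the functions below are the meromorphic continuations of the power series, which
  only converge for \<open>norm z < 1 / (1 - q)\<close>. On that disc they agree with the series: see
  \<open>qexp_sums\<close>, \<open>qcos_sums\<close> and \<open>qsin_sums\<close>. At a pole of \<open>qexp\<close> the convention
  \<open>1 / 0 = 0\<close> makes the product \<open>0\<close>; for \<open>qcos\<close> and \<open>qsin\<close> the poles lie
  on the imaginary axis.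
\<close>

definition qexp :: "real \<Rightarrow> complex \<Rightarrow> complex" where
  "qexp q z =
     (if q < 1 then (\<Prod>n. 1 / (1 - z * of_real ((1 - q) * q ^ n)))
      else (\<Sum>n. z ^ n / of_real (qfact q n)))"

definition qcos :: "real \<Rightarrow> complex \<Rightarrow> complex" where
  "qcos q z =
     (if q < 1 then (qexp q (\<i> * z) + qexp q (- \<i> * z)) / 2
      else (\<Sum>n. (-1) ^ n * z ^ (2 * n) / of_real (qfact q (2 * n))))"

definition qsin :: "real \<Rightarrow> complex \<Rightarrow> complex" where
  "qsin q z =
     (if q < 1 then (qexp q (\<i> * z) - qexp q (- \<i> * z)) / (2 * \<i>)
      else (\<Sum>n. (-1) ^ n * z ^ (2 * n + 1) / of_real (qfact q (2 * n + 1))))"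

definition qtan :: "real \<Rightarrow> complex \<Rightarrow> complex" where
  "qtan q z = qsin q z / qcos q z"

definition qcos_zero :: "real \<Rightarrow> real" where
  "qcos_zero q = (LEAST x. 0 < x \<and> qcos q (complex_of_real x) = 0)"

text \<open>The inverse of the bijection from \<open>{0..<qcos_zero q}\<close> onto \<open>{0..}\<close> given by \<open>qtan q\<close>.\<close>

definition qarctan :: "real \<Rightarrow> real \<Rightarrow> real" where
  "qarctan q y =
     the_inv_into {0..<qcos_zero q} (\<lambda>x. qtan q (complex_of_real x)) (complex_of_real y)"


section \<open>Agreement with the power series\<close>

lemma qfact_0 [simp]: "qfact q 0 = 1"
  by (simp add: qfact_def)

lemma qfact_Suc: "qfact q (Suc n) = (if q = 1 then real (Suc n) else qnum q (Suc n)) * qfact q n"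
  by (auto simp: qfact_def)

lemma qfact_Suc_lt1: "q < 1 \<Longrightarrow> qfact q (Suc n) = qnum q (Suc n) * qfact q n"
  by (simp add: qfact_Suc)

lemma qnum_ge:
  assumes "1 < q" shows "real n \<le> qnum q n"
proof -
  have "real n = (\<Sum>i<n. 1::real)" by simp
  also have "\<dots> \<le> (\<Sum>i<n. q ^ i)" using assms by (intro sum_mono) auto
  also have "\<dots> = qnum q n"
    using assms by (simp add: qnum_def geometric_sum divide_simps) (simp add: algebra_simps)
  finally show ?thesis .
qed

lemma qfact_ge_fact: "1 \<le> q \<Longrightarrow> fact n \<le> qfact q n"
proof (induction n)
  case (Suc n)
  have "real (Suc n) \<le> (if q = 1 then real (Suc n) else qnum q (Suc n))"
    using Suc.prems qnum_ge[of q "Suc n"] by auto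
  then show ?case
    unfolding qfact_Suc fact_Suc using Suc by (intro mult_mono) auto
qed simp

lemma qnum_pos:
  assumes "0 < q" "q < 1" shows "0 < qnum q (Suc n)"
  using assms by (simp add: qnum_def power_less_one_iff del: power_Suc)

lemma qfact_pos: "0 < q \<Longrightarrow> q < 1 \<Longrightarrow> 0 < qfact q n"
  by (induction n) (auto simp: qfact_Suc_lt1 qnum_pos)

lemma summable_qexp_ge1:
  fixes z :: complex
  assumes "1 \<le> q"
  shows "summable (\<lambda>n. z ^ n / of_real (qfact q n))"
proof (rule summable_comparison_test')
  show "summable (\<lambda>n. inverse (fact n) * norm z ^ n)" by (rule summable_exp)
  show "norm (z ^ n / of_real (qfact q n)) \<le> inverse (fact n) * norm z ^ n" if "n \<ge> 0" for n
  proof -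
    have "0 < (fact n :: real)" by simp
    then have "norm z ^ n / qfact q n \<le> norm z ^ n / fact n"
      using qfact_ge_fact[OF assms, of n]
      by (intro divide_left_mono mult_pos_pos zero_le_power norm_ge_zero) linarith+
    moreover have "0 \<le> qfact q n"
      using qfact_ge_fact[OF assms, of n] \<open>0 < (fact n :: real)\<close> by linarith
    ultimately show ?thesis
      by (simp add: norm_divide norm_power field_simps)
  qed
qed

lemma summable_qexp_lt1:
  fixes z :: complex
  assumes q: "0 < q" "q < 1" and z: "norm z < 1 / (1 - q)"
  shows "summable (\<lambda>n. z ^ n / of_real (qfact q n))"
proof -
  have "norm z * (1 - q) < 1" using q z by (simp add: field_simps)
  then obtain c where c: "norm z * (1 - q) < c" "c < 1" using dense by blast
  have "(\<lambda>n. q ^ Suc n) \<longlonglongrightarrow> 0"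
    using q by (intro LIMSEQ_Suc LIMSEQ_power_zero) auto
  then have "(\<lambda>n. norm z * ((1 - q) / (1 - q ^ Suc n))) \<longlonglongrightarrow> norm z * ((1 - q) / (1 - 0))"
    by (intro tendsto_intros) auto
  then have "eventually (\<lambda>n. norm z * ((1 - q) / (1 - q ^ Suc n)) < c) sequentially"
    using c(1) by (intro order_tendstoD) auto
  then obtain N where N: "\<And>n. n \<ge> N \<Longrightarrow> norm z * ((1 - q) / (1 - q ^ Suc n)) < c"
    unfolding eventually_sequentially by blast
  show ?thesis
  proof (rule summable_ratio_test[OF c(2)])
    fix n assume "n \<ge> N"
    have "norm (z ^ Suc n / of_real (qfact q (Suc n)))
        = norm z * ((1 - q) / (1 - q ^ Suc n)) * norm (z ^ n / of_real (qfact q n))"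
    proof -
      have "norm (z ^ Suc n / of_real (qfact q (Suc n))) = norm z ^ Suc n / qfact q (Suc n)"
        using qfact_pos[OF q, of "Suc n"] by (simp add: norm_divide norm_power del: power_Suc)
      also have "\<dots> = norm z / qnum q (Suc n) * (norm z ^ n / qfact q n)"
        by (simp add: qfact_Suc_lt1 q)
      also have "norm z ^ n / qfact q n = norm (z ^ n / of_real (qfact q n))"
        using qfact_pos[OF q, of n] by (simp add: norm_divide norm_power)
      finally show ?thesis by (simp add: qnum_def)
    qed
    also have "\<dots> \<le> c * norm (z ^ n / of_real (qfact q n))"
      using N[OF \<open>n \<ge> N\<close>] by (intro mult_right_mono) auto
    finally show "norm (z ^ Suc n / of_real (qfact q (Suc n)))
        \<le> c * norm (z ^ n / of_real (qfact q n))" .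
  qed
qed

lemma qexp_series_functional_equation:
  fixes z :: complex
  assumes q: "0 < q" "q < 1" and z: "norm z < 1 / (1 - q)"
  shows "(\<Sum>n. (of_real q * z) ^ n / of_real (qfact q n))
       = (1 - z * of_real (1 - q)) * (\<Sum>n. z ^ n / of_real (qfact q n))"
proof -
  define a where "a z n = z ^ n / of_real (qfact q n)" for z :: complex and n
  have sz: "summable (a z)" unfolding a_def by (rule summable_qexp_lt1[OF q z])
  have "norm (of_real q * z) \<le> norm z"
    using q by (simp add: norm_mult mult_left_le_one_le)
  then have sqz: "summable (a (of_real q * z))"
    unfolding a_def using z by (intro summable_qexp_lt1[OF q]) linarith
  have step: "a z (Suc n) - a (of_real q * z) (Suc n) = z * of_real (1 - q) * a z n" for n
  proof -
    have ne: "1 - q ^ Suc n \<noteq> 0" "1 - q \<noteq> 0" "qfact q n \<noteq> 0"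
      using qnum_pos[OF q, of n] qfact_pos[OF q, of n] q by (auto simp: qnum_def)
    have "a z (Suc n) - a (of_real q * z) (Suc n)
        = z ^ Suc n * of_real ((1 - q ^ Suc n) / qfact q (Suc n))"
      by (simp add: a_def power_mult_distrib diff_divide_distrib right_diff_distrib del: power_Suc)
    also have "(1 - q ^ Suc n) / qfact q (Suc n) = (1 - q) / qfact q n"
      using ne by (simp add: qfact_Suc_lt1 q qnum_def del: power_Suc)
    finally show ?thesis by (simp add: a_def)
  qed
  have "suminf (a z) - suminf (a (of_real q * z)) = (\<Sum>n. a z n - a (of_real q * z) n)"
    by (rule suminf_diff[OF sz sqz])
  also have "\<dots> = (\<Sum>n. a z (Suc n) - a (of_real q * z) (Suc n))"
    using suminf_split_head[OF summable_diff[OF sz sqz]] by (simp add: a_def)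
  also have "\<dots> = z * of_real (1 - q) * suminf (a z)"
    unfolding step by (rule suminf_mult[OF sz])
  finally have "suminf (a (of_real q * z)) = (1 - z * of_real (1 - q)) * suminf (a z)"
    by (simp add: algebra_simps)
  then show ?thesis unfolding a_def .
qed

lemma qexp_sums_lt1:
  assumes q: "0 < q" "q < 1" and z: "norm z < 1 / (1 - q)"
  shows "(\<lambda>n. z ^ n / of_real (qfact q n)) sums qexp q z"
proof -
  define E where "E w = (\<Sum>n. w ^ n / of_real (qfact q n))" for w :: complex
  define f where "f n = 1 - z * of_real ((1 - q) * q ^ n)" for n
  have small: "norm (of_real (q ^ n) * z) \<le> norm z" for n
    using q by (simp add: norm_mult norm_power mult_left_le_one_le power_le_one)
  have z1: "norm z * (1 - q) < 1" using q z by (simp add: field_simps)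
  have fnz: "f n \<noteq> 0" for n
  proof
    assume "f n = 0"
    then have "z * of_real ((1 - q) * q ^ n) = 1" by (simp add: f_def)
    then have "norm (z * of_real ((1 - q) * q ^ n)) = 1" by simp
    then have "norm (of_real (q ^ n) * z) * (1 - q) = 1"
      using q by (simp add: norm_mult norm_power abs_mult mult_ac
                       del: of_real_diff of_real_power of_real_mult)
    moreover have "norm (of_real (q ^ n) * z) * (1 - q) \<le> norm z * (1 - q)"
      using small[of n] q by (intro mult_right_mono) auto
    ultimately show False using z1 by linarith
  qed
  have iter: "E (of_real (q ^ n) * z) = (\<Prod>i<n. f i) * E z" for n
  proof (induction n)
    case (Suc n)
    have "norm (of_real (q ^ n) * z) < 1 / (1 - q)" using small[of n] z by linarith
    from qexp_series_functional_equation[OF q this]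
    have "E (of_real q * (of_real (q ^ n) * z)) = f n * E (of_real (q ^ n) * z)"
      by (simp add: E_def f_def mult_ac)
    then show ?case using Suc by (simp add: mult_ac)
  qed (simp add: E_def)
  have "isCont E 0"
  proof -
    define K where "K = 1 / (2 * (1 - q))"
    have "K < 1 / (1 - q)" "0 < K" using q by (simp_all add: K_def field_simps)
    then have "summable (\<lambda>n. (1 / of_real (qfact q n)) * complex_of_real K ^ n)"
      using summable_qexp_lt1[OF q, of "of_real K"] by (simp add: field_simps)
    moreover have "norm (0::complex) < norm (complex_of_real K)" using \<open>0 < K\<close> by simp
    ultimately have "isCont (\<lambda>w. \<Sum>n. (1 / of_real (qfact q n)) * w ^ n) (0::complex)"
      by (rule isCont_powser)
    then show ?thesis by (simp add: E_def[abs_def])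
  qed
  moreover have "E 0 = 1"
  proof -
    have "E 0 = (\<Sum>n. if n = 0 then 1 else 0)"
      unfolding E_def by (intro suminf_cong) auto
    also have "\<dots> = 1" using suminf_finite[of "{0::nat}" "\<lambda>n. if n = 0 then 1 else 0 :: complex"] by simp
    finally show ?thesis .
  qed
  moreover have "(\<lambda>n. complex_of_real (q ^ n) * z) \<longlonglongrightarrow> of_real 0 * z"
    using q by (intro tendsto_intros LIMSEQ_power_zero) auto
  ultimately have "(\<lambda>n. E (of_real (q ^ n) * z)) \<longlonglongrightarrow> 1"
    using isCont_tendsto_compose[of 0 E "\<lambda>n. complex_of_real (q ^ n) * z" sequentially] by simp
  then have lim1: "(\<lambda>n. (\<Prod>i<n. f i) * E z) \<longlonglongrightarrow> 1" by (simp only: iter)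
  have "summable (\<lambda>n. norm (f n - 1))"
  proof -
    have "summable (\<lambda>n. norm z * (1 - q) * q ^ n)"
      using q by (intro summable_mult summable_geometric) auto
    then show ?thesis
      using q by (simp add: f_def norm_mult norm_power abs_mult mult_ac
                       del: of_real_diff of_real_power of_real_mult)
  qed
  then have "convergent_prod f"
    by (intro abs_convergent_prod_imp_convergent_prod summable_imp_abs_convergent_prod)
  then have pos: "convergent_prod (\<lambda>n. inverse (f n))"
    by (rule convergent_prod_inverse)
  have lim2: "(\<lambda>n. (\<Prod>i<n. inverse (f i))) \<longlonglongrightarrow> prodinf (\<lambda>n. inverse (f n))"
    by (rule LIMSEQ_imp_Suc)
       (simp only: lessThan_Suc_atMost convergent_prod_LIMSEQ[OF pos])
  have cancel: "(\<Prod>i<n. inverse (f i)) * ((\<Prod>i<n. f i) * E z) = E z" for n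
    using fnz by (simp add: mult.assoc[symmetric] prod.distrib[symmetric])
  have "(\<lambda>n. E z) \<longlonglongrightarrow> prodinf (\<lambda>n. inverse (f n))"
    using tendsto_mult[OF lim2 lim1] by (simp only: cancel mult_1_right)
  then have "E z = prodinf (\<lambda>n. inverse (f n))"
    by (simp add: LIMSEQ_const_iff)
  also have "\<dots> = qexp q z"
    using q by (simp add: qexp_def f_def inverse_eq_divide)
  finally show ?thesis
    using summable_sums[OF summable_qexp_lt1[OF q z]] by (simp add: E_def)
qed

lemma qexp_sums:
  assumes "0 < q" and "q < 1 \<Longrightarrow> norm z < 1 / (1 - q)"
  shows "(\<lambda>n. z ^ n / of_real (qfact q n)) sums qexp q z"
proof (cases "q < 1")
  case True
  with assms show ?thesis by (intro qexp_sums_lt1) auto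
next
  case False
  then show ?thesis
    using summable_sums[OF summable_qexp_ge1[of q z]] by (simp add: qexp_def)
qed

lemma qcos_sums_qexp:
  assumes "0 < q" and "q < 1 \<Longrightarrow> norm z < 1 / (1 - q)"
  shows "(\<lambda>n. (-1) ^ n * z ^ (2 * n) / of_real (qfact q (2 * n)))
           sums ((qexp q (\<i> * z) + qexp q (- \<i> * z)) / 2)"
proof -
  have "(\<lambda>n. ((\<i> * z) ^ n / of_real (qfact q n) + (- \<i> * z) ^ n / of_real (qfact q n)) / 2)
          sums ((qexp q (\<i> * z) + qexp q (- \<i> * z)) / 2)" (is "?f sums _")
    using assms by (intro sums_divide sums_add qexp_sums) (auto simp: norm_mult)
  moreover have "strict_mono ((*) (2::nat))" by (simp add: strict_mono_def)
  moreover have "?f n = 0" if "n \<notin> range ((*) 2)" for n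
  proof -
    have "odd n" using that by (auto elim!: evenE)
    then show ?thesis by (simp add: power_mult_distrib power_minus_odd)
  qed
  ultimately have "(\<lambda>n. ?f (2 * n)) sums ((qexp q (\<i> * z) + qexp q (- \<i> * z)) / 2)"
    by (subst sums_mono_reindex) auto
  moreover have "?f (2 * n) = (-1) ^ n * z ^ (2 * n) / of_real (qfact q (2 * n))" for n
  proof -
    have "(\<i> * z) ^ (2 * n) = (-1) ^ n * z ^ (2 * n)" "(- \<i> * z) ^ (2 * n) = (-1) ^ n * z ^ (2 * n)"
      by (simp_all only: power_mult_distrib power_mult power2_i power2_minus)
    moreover have "(x / d + x / d) / 2 = x / d" for x d :: complex
      by (simp add: add_divide_distrib)
    ultimately show ?thesis by (simp only:)
  qed
  ultimately show ?thesis by (simp only:)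
qed

lemma qsin_sums_qexp:
  assumes "0 < q" and "q < 1 \<Longrightarrow> norm z < 1 / (1 - q)"
  shows "(\<lambda>n. (-1) ^ n * z ^ (2 * n + 1) / of_real (qfact q (2 * n + 1)))
           sums ((qexp q (\<i> * z) - qexp q (- \<i> * z)) / (2 * \<i>))"
proof -
  have "(\<lambda>n. ((\<i> * z) ^ n / of_real (qfact q n) - (- \<i> * z) ^ n / of_real (qfact q n)) / (2 * \<i>))
          sums ((qexp q (\<i> * z) - qexp q (- \<i> * z)) / (2 * \<i>))" (is "?f sums _")
    using assms by (intro sums_divide sums_diff qexp_sums) (auto simp: norm_mult)
  moreover have "strict_mono (\<lambda>n. 2 * n + 1 :: nat)" by (simp add: strict_mono_def)
  moreover have "?f n = 0" if "n \<notin> range (\<lambda>n. 2 * n + 1)" for n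
  proof -
    have "even n" using that by (metis oddE rangeI)
    then show ?thesis by (simp add: power_mult_distrib)
  qed
  ultimately have "(\<lambda>n. ?f (2 * n + 1)) sums ((qexp q (\<i> * z) - qexp q (- \<i> * z)) / (2 * \<i>))"
    by (subst sums_mono_reindex[where g = "\<lambda>n. 2 * n + 1"]) auto
  moreover have "?f (2 * n + 1) = (-1) ^ n * z ^ (2 * n + 1) / of_real (qfact q (2 * n + 1))" for n
  proof -
    have "(\<i> * z) ^ (2 * n + 1) = \<i> * ((-1) ^ n * z ^ (2 * n + 1))"
      "(- \<i> * z) ^ (2 * n + 1) = - (\<i> * ((-1) ^ n * z ^ (2 * n + 1)))"
      by (simp_all only: power_add power_one_right power_mult_distrib power_mult power2_i power2_minus)
         (simp_all only: mult_ac mult_minus_left mult_minus_right)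
    moreover have "(\<i> * x / d - - (\<i> * x) / d) / (2 * \<i>) = x / d" for x d :: complex
      by (simp add: divide_simps)
    ultimately show ?thesis by (simp only:)
  qed
  ultimately show ?thesis by (simp only:)
qed

lemma qcos_sums:
  assumes "0 < q" and "q < 1 \<Longrightarrow> norm z < 1 / (1 - q)"
  shows "(\<lambda>n. (-1) ^ n * z ^ (2 * n) / of_real (qfact q (2 * n))) sums qcos q z"
  using qcos_sums_qexp[OF assms] by (auto simp: qcos_def sums_iff)

lemma qsin_sums:
  assumes "0 < q" and "q < 1 \<Longrightarrow> norm z < 1 / (1 - q)"
  shows "(\<lambda>n. (-1) ^ n * z ^ (2 * n + 1) / of_real (qfact q (2 * n + 1))) sums qsin q z"
  using qsin_sums_qexp[OF assms] by (auto simp: qsin_def sums_iff)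


section \<open>The persistence probabilities\<close>

text \<open>The value at \<open>0\<close> is immaterial.\<close>

definition laplace_density :: "real \<Rightarrow> real \<Rightarrow> real" where
  "laplace_density \<xi> x = (if x < 0 then \<xi> * exp x else if x > 0 then (1 - \<xi>) * exp (- x) else 0)"

text \<open>For \<open>n = 0\<close> the condition is void, so the value in a probability space is \<open>1\<close>.\<close>

definition persistence :: "'a measure \<Rightarrow> (nat \<Rightarrow> 'a \<Rightarrow> real) \<Rightarrow> real \<Rightarrow> nat \<Rightarrow> real" where
  "persistence M X \<theta> n = \<P>(\<omega> in M. \<forall>k\<in>{1..n}. X (k + 1) \<omega> > \<theta> * X k \<omega>)"

end

(*
  Split the persistence probability started from x according to the sign of x. With q = -theta and
  w = sqrt (xi (1 - xi)), a suitable complex combination C(x) of the generating functions of the two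
  branches satisfies C'(x) = - i z w q exp (- q x) C(q x), whose solution is a q-exponential series.
  Since both branches agree at x = 0, the value C(0) = C(infinity) e_q(i w z) has a known argument,
  and this determines 1 + sum_n p_n z^(n+1) = h(z) / g(z) near 0.

  Since e_q(z) e_(1/q)(-z) = 1, the quotient h / g is the same for q and 1/q, so that one may take
  q >= 1, where everything is entire. There |e_q(-z)| < |e_q(z)| for Re z > 0 makes all zeros of g
  real, and tan_q is increasing, so the zero z_0 is simple and is the only one in the disc whose
  radius corresponds to the first zero of cos_q. The Taylor coefficients a_n of h / g therefore
  satisfy a_n z_0^(n+1) -> c.
*)
theory Submission
  imports Defs "HOL-Complex_Analysis.Complex_Analysis"
begin

text \<open>Let u_n(x) be the probability that n constraints hold from the start x, and p_n its
  mean. For x >= 0, u_(n+1)(x) is p_n minus xi times an integral of u_n(-s), and u_(n+1)(-x) is 1 -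
  xi times an integral of u_n(s), both against exp (- s) over s > q x. Weighting the two branches by
  sqrt (1 - xi) and sqrt xi makes both coupling constants equal to w up to sign; only then do they
  form the real and imaginary part of one function, with the single factor i w. All this is done
  coefficientwise in z: the coefficient of z^n is a finite sum of exponentials in x, verified by
  induction on n, and power series in z enter only at x = 0.

  For q > 1 the analysis of e_q rests on e_q(q z) = (1 + (q - 1) z) e_q(z). A property that holds
  near 0 and survives this factor spreads over the half-plane Re z >= 0. Three properties are
  obtained so: e_q has no zero there, |e_q(-z)| < |e_q(z)| in the interior, and e_q'/e_q has
  positive real part. The last one, on the imaginary axis, gives both the monotone tangent and the
  simple zero.\<close>

section \<open>Taylor coefficients and a dominant simple pole\<close>

text \<open>The product \<open>(z0 - z) * A z\<close> continues holomorphically to the whole ball,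
  which contains \<open>z0\<close>, so its Taylor series converges at \<open>z0\<close> itself. The
  partial sums there are exactly the sequence in question.\<close>

lemma simple_pole_coeff_asymptotics:
  fixes a :: "nat \<Rightarrow> complex" and A H G :: "complex \<Rightarrow> complex"
  assumes holH: "H holomorphic_on ball 0 \<rho>" and holG: "G holomorphic_on ball 0 \<rho>"
    and z0: "z0 \<in> ball 0 \<rho>" "G z0 = 0" "deriv G z0 \<noteq> 0"
    and uniq: "\<And>z. z \<in> ball 0 \<rho> \<Longrightarrow> G z = 0 \<Longrightarrow> z = z0"
    and r: "0 < r" and A: "\<And>z. norm z < r \<Longrightarrow> (\<lambda>n. a n * z ^ n) sums A z"
    and AG: "\<And>z. norm z < r \<Longrightarrow> A z * G z = H z"
  shows "(\<lambda>n. a n * z0 ^ Suc n) \<longlonglongrightarrow> - (H z0 / deriv G z0)"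
proof -
  \<comment> \<open>Minus the difference quotient of \<open>G\<close> at \<open>z0\<close>,
    continued by the derivative: \<open>G z = (z0 - z) * K z\<close>, and \<open>K\<close> has no
    zero in the ball.\<close>
  define K where "K z = - (if z = z0 then deriv G z0 else (G z - G z0) / (z - z0))" for z
  define m where "m z = H z / K z" for z
  have holK: "K holomorphic_on ball 0 \<rho>"
    unfolding K_def[abs_def] using z0 by (intro holomorphic_on_minus pole_lemma[OF holG]) auto
  have GK: "G z = (z0 - z) * K z" for z
    using z0(2) by (auto simp: K_def divide_simps) (simp add: algebra_simps)
  have Knz: "K z \<noteq> 0" if "z \<in> ball 0 \<rho>" for z
  proof (cases "z = z0")
    case True
    then show ?thesis using z0 by (simp add: K_def)
  next
    case False
    then show ?thesis using uniq[OF that] GK[of z] by auto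
  qed
  have holm: "m holomorphic_on ball 0 \<rho>"
    unfolding m_def[abs_def] by (intro holomorphic_on_divide holH holK Knz)
  have \<rho>: "\<rho> > 0" using z0(1) norm_ge_zero[of z0] by (simp del: norm_ge_zero)
  define c where "c n = (deriv ^^ n) m 0 / fact n" for n
  have c: "(\<lambda>n. c n * z ^ n) sums m z" if "z \<in> ball 0 \<rho>" for z
    using holomorphic_power_series[OF holm that] by (simp add: c_def)
  have m_fps: "m has_fps_expansion Abs_fps c"
    using has_fps_expansion_fps_expansion[OF open_ball _ holm] \<rho>
    by (simp add: fps_expansion_def c_def[abs_def])
  have "summable (\<lambda>n. a n * of_real (r / 2) ^ n)"
    using A[of "of_real (r / 2)"] r by (auto simp: sums_iff)
  then have "conv_radius a \<ge> norm (complex_of_real (r / 2))"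
    by (intro conv_radius_geI)
  then have a_rad: "fps_conv_radius (Abs_fps a) > 0"
    using r by (simp add: fps_conv_radius_def) (metis less_le_trans ereal_less(2) half_gt_zero)
  have a_fps: "eval_fps (Abs_fps a) has_fps_expansion Abs_fps a"
    using a_rad by (simp add: has_fps_expansion_def)
  have "(\<lambda>z. (z0 - z) * eval_fps (Abs_fps a) z) has_fps_expansion (fps_const z0 - fps_X) * Abs_fps a"
    by (intro fps_expansion_intros a_fps)
  moreover have "\<forall>\<^sub>F z in nhds 0. m z = (z0 - z) * eval_fps (Abs_fps a) z"
  proof -
    have "\<forall>\<^sub>F z in nhds 0. z \<in> ball 0 (min r \<rho>)"
      using r \<rho> by (intro eventually_nhds_in_open) auto
    then show ?thesis
    proof eventually_elim
      case (elim z)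
      then have z: "norm z < r" "z \<in> ball 0 \<rho>" by auto
      have "eval_fps (Abs_fps a) z = A z"
        using A[OF z(1)] by (simp add: eval_fps_def sums_iff)
      moreover have "m z = (z0 - z) * A z"
        using AG[OF z(1)] Knz[OF z(2)] GK[of z] by (simp add: m_def field_simps)
      ultimately show ?case by simp
    qed
  qed
  ultimately have "m has_fps_expansion (fps_const z0 - fps_X) * Abs_fps a"
    using has_fps_expansion_cong by fast
  from fps_expansion_unique_complex[OF m_fps this]
  have ceq: "c n = fps_nth ((fps_const z0 - fps_X) * Abs_fps a) n" for n
    by (metis fps_nth_Abs_fps)
  have c0: "c 0 = z0 * a 0" and cS: "c (Suc n) = z0 * a (Suc n) - a n" for n
    by (simp_all add: ceq left_diff_distrib)
  \<comment> \<open>Since \<open>m = (z0 - z) * A\<close>, its Taylor partial sums at \<open>z0\<close> telescope.\<close>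
  have partial: "(\<Sum>k\<le>n. c k * z0 ^ k) = a n * z0 ^ Suc n" for n
    by (induction n) (simp_all add: c0 cS algebra_simps)
  have "(\<lambda>n. \<Sum>k\<le>n. c k * z0 ^ k) \<longlonglongrightarrow> m z0"
    using c[OF z0(1)] by (simp add: sums_def_le)
  then show ?thesis
    by (simp add: partial m_def K_def)
qed

lemma simple_zero_quotient_tendsto:
  fixes G H :: "complex \<Rightarrow> complex"
  assumes G: "(G has_field_derivative D) (at z0)" "G z0 = 0" "D \<noteq> 0" and H: "isCont H z0"
  shows "((\<lambda>z. (z0 - z) * (H z / G z)) \<longlongrightarrow> - (H z0 / D)) (at z0)"
proof -
  have "((\<lambda>z. - (H z / ((G z - G z0) / (z - z0)))) \<longlongrightarrow> - (H z0 / D)) (at z0)"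
    using G(1,3) H by (intro tendsto_minus tendsto_divide) (auto simp: has_field_derivative_iff isCont_def)
  moreover have "\<forall>\<^sub>F z in at z0. - (H z / ((G z - G z0) / (z - z0))) = (z0 - z) * (H z / G z)"
    by (intro always_eventually allI) (simp add: G(2) minus_divide_left algebra_simps)
  ultimately show ?thesis using tendsto_cong by fast
qed


section \<open>The $q$-exponential function\<close>

lemma qexp_0 [simp]:
  assumes "0 < q" shows "qexp q 0 = 1"
  using qexp_sums[of q 0] powser_sums_zero[of "\<lambda>n. 1 / complex_of_real (qfact q n)"] assms
  by (auto simp: sums_iff)

lemma qexp_1: "qexp 1 = exp"
  by (rule ext) (simp add: qexp_def exp_def qfact_def scaleR_conv_of_real field_simps)

text \<open>The factor \<open>q ^ Suc n - 1\<close> cancels the last factor of the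
  \<open>q\<close>-factorial. This is the counterpart of
  \<open>qexp_series_functional_equation\<close>; for \<open>1 < q\<close> the estimates in the
  half-plane \<open>0 \<le> Re z\<close> all rest on it.\<close>

lemma qexp_mult_q:
  assumes "1 < q"
  shows "qexp q (of_real q * z) = (1 + of_real (q - 1) * z) * qexp q z"
proof -
  define a where "a z n = z ^ n / of_real (qfact q n)" for z :: complex and n
  have sm: "summable (a z)" for z
    unfolding a_def using assms by (intro summable_qexp_ge1) simp
  have step: "a (of_real q * z) (Suc n) - a z (Suc n) = of_real (q - 1) * z * a z n" for n
  proof -
    have ne: "1 - q ^ Suc n \<noteq> 0" "1 - q \<noteq> 0"
      using assms one_less_power[of q "Suc n"] by auto
    have ne': "qfact q n \<noteq> 0"
      using qfact_ge_fact[of q n] fact_gt_zero[of n, where ?'a = real] assms by linarith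
    have "a (of_real q * z) (Suc n) - a z (Suc n)
        = z ^ Suc n * of_real ((q ^ Suc n - 1) / qfact q (Suc n))"
      by (simp add: a_def power_mult_distrib diff_divide_distrib right_diff_distrib del: power_Suc)
    also have "(q ^ Suc n - 1) / qfact q (Suc n) = (q - 1) / qfact q n"
      using ne ne' assms by (simp add: qfact_Suc qnum_def divide_simps del: power_Suc)
        (simp add: algebra_simps)
    finally show ?thesis by (simp add: a_def)
  qed
  have "suminf (a (of_real q * z)) - suminf (a z) = (\<Sum>n. a (of_real q * z) n - a z n)"
    by (rule suminf_diff[OF sm sm])
  also have "\<dots> = (\<Sum>n. a (of_real q * z) (Suc n) - a z (Suc n))"
    using suminf_split_head[OF summable_diff[OF sm sm, of "of_real q * z" z]] by (simp add: a_def)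
  also have "\<dots> = of_real (q - 1) * z * suminf (a z)"
    unfolding step by (rule suminf_mult[OF sm])
  finally have "suminf (a (of_real q * z)) = (1 + of_real (q - 1) * z) * suminf (a z)"
    by (simp add: algebra_simps)
  then show ?thesis using assms by (simp add: qexp_def a_def[abs_def])
qed

lemma holomorphic_qexp:
  assumes "1 \<le> q" shows "qexp q holomorphic_on A"
proof -
  have "qexp q holomorphic_on ball 0 r" for r
  proof (rule power_series_holomorphic)
    show "(\<lambda>n. 1 / of_real (qfact q n) * (w - 0) ^ n) sums qexp q w" for w
      using qexp_sums[of q w] assms by simp
  qed
  then have "qexp q field_differentiable at z" for z
    by (rule holomorphic_on_imp_differentiable_at[of _ "ball 0 (norm z + 1)"]) auto
  then show ?thesis
    by (simp add: holomorphic_on_def field_differentiable_at_within)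
qed

lemma qexp_field_derivative:
  "1 \<le> q \<Longrightarrow> (qexp q has_field_derivative deriv (qexp q) z) (at z)"
  using holomorphic_derivI[OF holomorphic_qexp open_UNIV] by blast

lemma isCont_qexp: "1 \<le> q \<Longrightarrow> isCont (qexp q) z"
  using qexp_field_derivative DERIV_isCont by blast

lemma cnj_qexp:
  assumes "1 \<le> q" shows "cnj (qexp q z) = qexp q (cnj z)"
proof -
  have "(\<lambda>n. cnj (z ^ n / of_real (qfact q n))) sums cnj (qexp q z)"
    unfolding sums_cnj using assms by (intro qexp_sums) auto
  moreover have "(\<lambda>n. cnj z ^ n / of_real (qfact q n)) sums qexp q (cnj z)"
    using assms by (intro qexp_sums) auto
  ultimately show ?thesis
    by (simp add: sums_iff)
qed

text \<open>Combined with \<open>qexp_mult_q\<close>, this replaces the infinite product for \<open>qexp q\<close>.\<close>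

lemma dilation_induct [consumes 3, case_names step]:
  fixes q :: real and z :: complex
  assumes q: "1 < q" and ev: "\<forall>\<^sub>F z in nhds 0. P z" and z: "0 \<le> Re z"
    and step: "\<And>z. 0 \<le> Re z \<Longrightarrow> P z \<Longrightarrow> P (of_real q * z)"
  shows "P z"
proof -
  \<comment> \<open>The points \<open>z / q ^ n\<close> tend to \<open>0\<close>, so some of them
    satisfies \<open>P\<close>; then \<open>n\<close> steps along the ray lead back to
    \<open>z\<close>.\<close>
  have "(\<lambda>n. z * of_real ((1 / q) ^ n)) \<longlonglongrightarrow> z * of_real 0"
    using q by (intro tendsto_intros LIMSEQ_power_zero) auto
  then have "\<forall>\<^sub>F n in sequentially. P (z * of_real ((1 / q) ^ n))"
    using ev by (simp add: filterlim_iff)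
  then obtain n where n: "P (z * of_real ((1 / q) ^ n))"
    using eventually_happens trivial_limit_sequentially by blast
  have "P (z * of_real (q ^ m * (1 / q) ^ n))" for m
  proof (induction m)
    case (Suc m)
    have "0 \<le> Re (z * of_real (q ^ m * (1 / q) ^ n))"
      using z q by simp
    from step[OF this Suc] show ?case by (simp add: mult_ac)
  qed (use n in simp)
  from this[of n] show ?thesis
    using q by (simp add: power_one_over)
qed

lemma one_plus_nonzero: "0 \<le> Re z \<Longrightarrow> 0 \<le> c \<Longrightarrow> 1 + of_real c * z \<noteq> 0"
proof
  assume *: "0 \<le> Re z" "0 \<le> c" "1 + of_real c * z = 0"
  have "0 < Re (1 + of_real c * z)" using *(1,2) by (simp add: add_pos_nonneg)
  then show False unfolding *(3) by simp
qed

lemma qexp_nonzero: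
  assumes "1 \<le> q" "0 \<le> Re z" shows "qexp q z \<noteq> 0"
proof (cases "q = 1")
  case False
  with assms have q: "1 < q" by simp
  have "\<forall>\<^sub>F z in nhds 0. qexp q z \<noteq> 0"
  proof (rule tendsto_imp_eventually_ne)
    show "(qexp q \<longlongrightarrow> qexp q 0) (nhds 0)"
      using isCont_qexp[OF assms(1), of 0] by (simp only: isCont_def tendsto_at_iff_tendsto_nhds)
    show "qexp q 0 \<noteq> 0" using q by simp
  qed
  from q this assms(2) show ?thesis
  proof (induction rule: dilation_induct)
    case (step z)
    then show ?case
      using one_plus_nonzero[of z "q - 1"] q by (simp add: qexp_mult_q)
  qed
qed (simp add: qexp_1)

lemma norm_one_minus_less:
  assumes "0 < Re z" "0 < c" shows "norm (1 - of_real c * z) < norm (1 + of_real c * z)"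
proof (rule power2_less_imp_less)
  have "(1 - c * Re z)\<^sup>2 < (1 + c * Re z)\<^sup>2"
    using assms by (simp add: power2_eq_square algebra_simps)
  then show "(norm (1 - of_real c * z))\<^sup>2 < (norm (1 + of_real c * z))\<^sup>2"
    by (simp add: cmod_power2)
qed simp

lemma norm_one_minus_le:
  assumes "0 \<le> Re z" "0 \<le> c" shows "norm (1 - of_real c * z) \<le> norm (1 + of_real c * z)"
proof (rule power2_le_imp_le)
  have "(1 - c * Re z)\<^sup>2 \<le> (1 + c * Re z)\<^sup>2"
    using assms by (simp add: power2_eq_square algebra_simps)
  then show "(norm (1 - of_real c * z))\<^sup>2 \<le> (norm (1 + of_real c * z))\<^sup>2"
    by (simp add: cmod_power2)
qed simp

text \<open>For \<open>1 < q\<close> a dilation step multiplies the two sides by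
  \<open>norm (1 - (q - 1) * z)\<close> and \<open>norm (1 + (q - 1) * z)\<close>; the first is
  smaller in the open right half-plane.\<close>

lemma norm_qexp_minus_less:
  assumes "1 \<le> q" "0 < Re z" shows "norm (qexp q (- z)) < norm (qexp q z)"
proof (cases "q = 1")
  case True
  then show ?thesis using assms by (simp add: qexp_1)
next
  case False
  with assms have q: "1 < q" by simp
  \<comment> \<open>Both norms are \<open>1\<close> at \<open>0\<close>, so continuity alone does
    not give the inequality nearby. A factor \<open>t < 1\<close> makes it strict at
    \<open>0\<close>, hence valid near \<open>0\<close>; letting \<open>t\<close> tend to
    \<open>1\<close> gives the weak form, and one more dilation step makes that strict.\<close>
  have weak: "norm (qexp q (- z)) \<le> norm (qexp q z)" if z: "0 \<le> Re z" for z
  proof (rule field_le_mult_one_interval)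
    fix t :: real assume t: "0 < t" "t < 1"
    have "((\<lambda>z. norm (qexp q z) - t * norm (qexp q (- z))) \<longlongrightarrow> norm (qexp q 0) - t * norm (qexp q (- 0))) (nhds 0)"
      using isCont_qexp[OF assms(1), of 0] unfolding isCont_def tendsto_at_iff_tendsto_nhds
      by (intro tendsto_intros) (auto intro!: filterlim_compose[of "qexp q" _ "nhds 0"] tendsto_eq_intros filterlim_ident)
    then have "\<forall>\<^sub>F z in nhds 0. 0 < norm (qexp q z) - t * norm (qexp q (- z))"
      using t q by (auto dest!: order_tendstoD(1)[where a = 0])
    then have "\<forall>\<^sub>F z in nhds 0. t * norm (qexp q (- z)) \<le> norm (qexp q z)"
      by eventually_elim simp
    from q this z show "t * norm (qexp q (- z)) \<le> norm (qexp q z)"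
    proof (induction rule: dilation_induct)
      case (step z)
      have "t * norm (qexp q (- (of_real q * z))) = norm (1 - of_real (q - 1) * z) * (t * norm (qexp q (- z)))"
        using qexp_mult_q[OF q, of "- z"] by (simp add: norm_mult)
      also have "\<dots> \<le> norm (1 + of_real (q - 1) * z) * norm (qexp q z)"
        using step q t by (intro mult_mono norm_one_minus_le) auto
      finally show ?case by (simp add: qexp_mult_q[OF q] norm_mult)
    qed
  qed
  define w where "w = z / of_real q"
  have w: "z = of_real q * w" "0 < Re w" using q assms by (simp_all add: w_def)
  have "norm (qexp q (- z)) = norm (1 - of_real (q - 1) * w) * norm (qexp q (- w))"
    using qexp_mult_q[OF q, of "- w"] by (simp add: norm_mult w)
  also have "\<dots> \<le> norm (1 - of_real (q - 1) * w) * norm (qexp q w)"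
    using w by (intro mult_left_mono weak) auto
  also have "\<dots> < norm (1 + of_real (q - 1) * w) * norm (qexp q w)"
    using w q qexp_nonzero[OF assms(1), of w]
    by (intro mult_strict_right_mono norm_one_minus_less) auto
  finally show ?thesis by (simp add: qexp_mult_q[OF q] norm_mult w)
qed

text \<open>Logarithmic differentiation of \<open>qexp_mult_q\<close> gives an equation that forces
  the value \<open>1\<close> at \<open>0\<close> and adds a term of nonnegative real part at each
  dilation. On the imaginary axis the result says that the argument of
  \<open>qexp q (\<i> * x)\<close> increases with \<open>x\<close>.\<close>

lemma Re_logderiv_qexp_pos:
  assumes "1 \<le> q" "0 \<le> Re z" shows "0 < Re (deriv (qexp q) z / qexp q z)"
proof (cases "q = 1")
  case True
  then show ?thesis by (simp add: qexp_1 DERIV_imp_deriv[OF DERIV_exp])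
next
  case False
  with assms have q: "1 < q" by simp
  define L where "L z = deriv (qexp q) z / qexp q z" for z
  have L: "of_real q * L (of_real q * z) = of_real (q - 1) / (1 + of_real (q - 1) * z) + L z"
    if z: "0 \<le> Re z" for z
  proof -
    have "((\<lambda>z. qexp q (of_real q * z)) has_field_derivative deriv (qexp q) (of_real q * z) * of_real q) (at z)"
      using assms by (intro DERIV_chain2[OF qexp_field_derivative]) (auto intro!: derivative_eq_intros)
    moreover have "((\<lambda>z. (1 + of_real (q - 1) * z) * qexp q z) has_field_derivative
       (of_real (q - 1) * qexp q z + (1 + of_real (q - 1) * z) * deriv (qexp q) z)) (at z)"
      using assms by (auto intro!: derivative_eq_intros qexp_field_derivative)
    ultimately have "deriv (qexp q) (of_real q * z) * of_real q
        = of_real (q - 1) * qexp q z + (1 + of_real (q - 1) * z) * deriv (qexp q) z"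
      unfolding qexp_mult_q[OF q] by (rule DERIV_unique)
    then have "L (of_real q * z) * of_real q
      = (of_real (q - 1) * qexp q z + (1 + of_real (q - 1) * z) * deriv (qexp q) z)
        / ((1 + of_real (q - 1) * z) * qexp q z)"
      by (simp only: L_def qexp_mult_q[OF q] times_divide_eq_left)
    also have "\<dots> = of_real (q - 1) / (1 + of_real (q - 1) * z) + L z"
      using qexp_nonzero[OF assms(1) z] one_plus_nonzero[OF z, of "q - 1"] q
      by (simp add: L_def add_divide_distrib del: of_real_diff)
    finally show ?thesis by (simp only: mult.commute)
  qed
  have "of_real q * L 0 = of_real (q - 1) + L 0" using L[of 0] by simp
  then have "of_real (q - 1) * L 0 = of_real (q - 1)" by (simp add: algebra_simps)
  then have L0: "L 0 = 1" using q by (simp del: of_real_diff)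
  have "isCont L 0"
    unfolding L_def[abs_def] using assms
    by (intro continuous_divide isCont_qexp) 
       (auto intro!: holomorphic_on_imp_continuous_on continuous_on_interior
          [of UNIV "deriv (qexp q)"] holomorphic_deriv holomorphic_qexp)
  then have "((\<lambda>z. Re (L z)) \<longlongrightarrow> Re (L 0)) (nhds 0)"
    unfolding isCont_def tendsto_at_iff_tendsto_nhds by (intro tendsto_intros)
  then have "\<forall>\<^sub>F z in nhds 0. 0 < Re (L z)"
    by (rule order_tendstoD) (simp add: L0)
  from q this assms(2) have "0 < Re (L z)"
  proof (induction rule: dilation_induct)
    case (step z)
    have "0 < Re (1 + of_real (q - 1) * z)" using q step by (simp add: add_pos_nonneg)
    then have "0 \<le> Re (of_real (q - 1) / (1 + of_real (q - 1) * z))"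
      using q by (simp add: Re_divide)
    then have "0 < Re (of_real q * L (of_real q * z))"
      using step L[of z] by simp
    then show ?case using q by (simp add: zero_less_mult_iff)
  qed
  then show ?thesis by (simp add: L_def)
qed


section \<open>Zeros of $q$-trigonometric functions\<close>

lemma qcos_qexp: "0 < q \<Longrightarrow> qcos q z = (qexp q (\<i> * z) + qexp q (- \<i> * z)) / 2"
  using sums_unique2[OF qcos_sums qcos_sums_qexp, of q z] by (cases "q < 1") (auto simp: qcos_def)

lemma qsin_qexp: "0 < q \<Longrightarrow> qsin q z = (qexp q (\<i> * z) - qexp q (- \<i> * z)) / (2 * \<i>)"
  using sums_unique2[OF qsin_sums qsin_sums_qexp, of q z] by (cases "q < 1") (auto simp: qsin_def)

lemma qexp_qcos_qsin:
  assumes "0 < q"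
  shows "qexp q (\<i> * z) = qcos q z + \<i> * qsin q z" "qexp q (- \<i> * z) = qcos q z - \<i> * qsin q z"
  using assms by (simp_all add: qcos_qexp qsin_qexp field_simps)

text \<open>For \<open>1 \<le> q\<close> these are \<open>qcos q\<close> and \<open>qsin q\<close>
  on the real line, because \<open>qexp q\<close> commutes with \<open>cnj\<close>. As parts of one
  function they inherit what is known of \<open>qexp q\<close> on the imaginary axis.\<close>

definition rcos :: "real \<Rightarrow> real \<Rightarrow> real" where
  "rcos q x = Re (qexp q (\<i> * of_real x))"

definition rsin :: "real \<Rightarrow> real \<Rightarrow> real" where
  "rsin q x = Im (qexp q (\<i> * of_real x))"

context
  fixes q :: real assumes q: "1 \<le> q"
begin

lemma qcos_of_real: "qcos q (of_real x) = of_real (rcos q x)"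
  using q complex_add_cnj[of "qexp q (\<i> * of_real x)"] by (simp add: qcos_qexp rcos_def cnj_qexp)

lemma qsin_of_real: "qsin q (of_real x) = of_real (rsin q x)"
  using q complex_diff_cnj[of "qexp q (\<i> * of_real x)"] by (simp add: qsin_qexp rsin_def cnj_qexp) (simp add: complex_eq_iff)

lemma rcos_0: "rcos q 0 = 1" and rsin_0: "rsin q 0 = 0"
  using q by (simp_all add: rcos_def rsin_def)

lemma rcos_minus: "rcos q (- x) = rcos q x" and rsin_minus: "rsin q (- x) = - rsin q x"
  using cnj_qexp[OF q, of "\<i> * of_real x"] by (simp_all add: rcos_def rsin_def complex_eq_iff)

lemma qexp_imaginary_derivative:
  "((\<lambda>x. qexp q (\<i> * of_real x)) has_vector_derivative \<i> * deriv (qexp q) (\<i> * of_real x)) (at x)"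
proof -
  have "((\<lambda>z. qexp q (\<i> * z)) has_field_derivative deriv (qexp q) (\<i> * of_real x) * \<i>) (at (of_real x))"
    by (intro DERIV_chain2[OF qexp_field_derivative[OF q]]) (auto intro!: derivative_eq_intros)
  from has_vector_derivative_real_field[OF this] show ?thesis by (simp add: mult.commute)
qed

lemma rcos_derivative:
    "(rcos q has_real_derivative Re (\<i> * deriv (qexp q) (\<i> * of_real x))) (at x)"
  and rsin_derivative:
    "(rsin q has_real_derivative Im (\<i> * deriv (qexp q) (\<i> * of_real x))) (at x)"
  unfolding rcos_def[abs_def] rsin_def[abs_def]
  by (intro has_field_derivative_Re has_field_derivative_Im qexp_imaginary_derivative)+

lemma isCont_rcos: "isCont (rcos q) x" and isCont_rsin: "isCont (rsin q) x"
  using rcos_derivative rsin_derivative DERIV_isCont by blast+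

text \<open>With \<open>e\<close> the value and \<open>d\<close> the derivative of
  \<open>qexp q\<close> at \<open>\<i> * x\<close>, the expression is
  \<open>Re (d / e) * norm e ^ 2\<close>.\<close>

lemma wronskian_pos:
  "0 < Im (\<i> * deriv (qexp q) (\<i> * of_real x)) * rcos q x - Re (\<i> * deriv (qexp q) (\<i> * of_real x)) * rsin q x"
proof -
  define e d where "e = qexp q (\<i> * of_real x)" and "d = deriv (qexp q) (\<i> * of_real x)"
  have e: "e \<noteq> 0" unfolding e_def by (rule qexp_nonzero[OF q]) simp
  have "0 < Re (d / e)" unfolding e_def d_def by (rule Re_logderiv_qexp_pos[OF q]) simp
  then have "0 < Re d * Re e + Im d * Im e"
    by (auto simp: Re_divide zero_less_divide_iff not_sum_power2_lt_zero)
  then show ?thesis by (simp add: rcos_def rsin_def e_def d_def algebra_simps)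
qed

lemma rtan_strict_mono:
  assumes "x < y" and pos: "\<And>t. x \<le> t \<Longrightarrow> t \<le> y \<Longrightarrow> 0 < rcos q t"
  shows "rsin q x / rcos q x < rsin q y / rcos q y"
proof (rule DERIV_pos_imp_increasing[OF assms(1)])
  fix t assume t: "x \<le> t" "t \<le> y"
  let ?d = "\<i> * deriv (qexp q) (\<i> * of_real t)"
  have "((\<lambda>t. rsin q t / rcos q t) has_real_derivative
      (Im ?d * rcos q t - rsin q t * Re ?d) / (rcos q t * rcos q t)) (at t)"
    using pos[OF t] by (intro DERIV_divide rcos_derivative rsin_derivative) auto
  moreover have "0 < (Im ?d * rcos q t - rsin q t * Re ?d) / (rcos q t * rcos q t)"
    using wronskian_pos[of t] pos[OF t] by (simp add: mult.commute)
  ultimately show "\<exists>D. ((\<lambda>t. rsin q t / rcos q t) has_real_derivative D) (at t) \<and> 0 < D" by blast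
qed

text \<open>
  If \<open>rcos q\<close> had no zero, then \<open>rcos q (q * x) > 0\<close> would bound \<open>rsin q x / rcos q x\<close> by
  \<open>1 / ((q - 1) * x)\<close>, although this quotient is positive and increasing.
\<close>

lemma rcos_zero_exists: "\<exists>x>0. rcos q x = 0"
proof (cases "q = 1")
  case True
  have "rcos q (pi / 2) = 0" unfolding True unfolding rcos_def qexp_1 cis_conv_exp[symmetric] by simp
  then show ?thesis by (intro exI[of _ "pi / 2"]) auto
next
  case False
  with q have q1: "1 < q" by simp
  show ?thesis
  proof (rule ccontr)
    assume no: "\<not> ?thesis"
    have pos: "0 < rcos q x" if "0 \<le> x" for x
    proof (rule ccontr)
      assume "\<not> 0 < rcos q x"
      then have "\<exists>t\<ge>0. t \<le> x \<and> rcos q t = 0"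
        using that by (intro IVT2) (auto simp: rcos_0 isCont_rcos)
      then show False using no rcos_0 by (metis less_eq_real_def zero_neq_one)
    qed
    define T where "T = rsin q 1 / rcos q 1"
    have T: "0 < T" using rtan_strict_mono[of 0 1] pos by (simp add: T_def rsin_0)
    \<comment> \<open>Large enough that the increasing quotient is still at least \<open>T\<close>
      and that \<open>(q - 1) * x * T \<ge> 1\<close>. The real part of \<open>qexp_mult_q\<close>
      at \<open>\<i> * x\<close> then makes \<open>rcos q (q * x)\<close> nonpositive.\<close>
    define x where "x = max 1 (1 / ((q - 1) * T))"
    have "T \<le> rsin q x / rcos q x"
    proof (cases "x = 1")
      case False
      then have "1 < x" by (simp add: x_def)
      then show ?thesis
        unfolding T_def by (intro less_imp_le rtan_strict_mono pos) auto
    qed (simp add: T_def)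
    then have "T * rcos q x \<le> rsin q x"
      using pos[of x] by (simp add: x_def pos_le_divide_eq)
    moreover have "1 \<le> (q - 1) * x * T"
    proof -
      have "1 / ((q - 1) * T) \<le> x" by (simp add: x_def)
      then show ?thesis using T q1 by (simp add: field_simps)
    qed
    moreover have x0: "0 < x" by (simp add: x_def)
    ultimately have "1 * rcos q x \<le> (q - 1) * x * T * rcos q x"
        "(q - 1) * x * (T * rcos q x) \<le> (q - 1) * x * rsin q x"
      using pos[of x] q1 by (intro mult_right_mono mult_left_mono; simp)+
    then have "rcos q x \<le> (q - 1) * x * rsin q x" by (simp add: mult_ac)
    moreover have "rcos q (q * x) = rcos q x - (q - 1) * x * rsin q x"
      using qexp_mult_q[OF q1, of "\<i> * of_real x"] by (simp add: rcos_def rsin_def mult_ac)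
    ultimately show False using pos[of "q * x"] x0 q1 by simp
  qed
qed

text \<open>\<open>LEAST\<close> over the reals is meaningful only if the minimum is attained: the
  zeros in \<open>{0..b}\<close> form a nonempty compact set, and \<open>0\<close> is not among
  them.\<close>

lemma qcos_zero_pos: "0 < qcos_zero q"
  and rcos_qcos_zero: "rcos q (qcos_zero q) = 0"
  and rcos_pos: "\<bar>x\<bar> < qcos_zero q \<Longrightarrow> 0 < rcos q x"
proof -
  obtain b where b: "0 < b" "rcos q b = 0" using rcos_zero_exists by blast
  define Z where "Z = {x \<in> {0..b}. rcos q x = 0}"
  have "Z = {0..b} \<inter> {x. rcos q x = 0}" by (auto simp: Z_def)
  moreover have "closed {x. rcos q x = 0}"
    using isCont_rcos by (intro closed_Collect_eq continuous_intros continuous_at_imp_continuous_on) auto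
  ultimately have "compact Z" by (simp add: compact_Int_closed)
  moreover have "Z \<noteq> {}" using b by (auto simp: Z_def)
  ultimately obtain m where m: "m \<in> Z" "\<And>x. x \<in> Z \<Longrightarrow> m \<le> x"
    using compact_attains_inf by metis
  have m0: "0 < m" using m(1) rcos_0 by (cases "m = 0") (auto simp: Z_def)
  have least: "m \<le> x" if "0 < x" "rcos q x = 0" for x
    using m that by (cases "x \<le> b") (auto simp: Z_def)
  have zero: "qcos_zero q = m"
    unfolding qcos_zero_def using m m0 least by (intro Least_equality) (auto simp: qcos_of_real Z_def)
  show "0 < qcos_zero q" "rcos q (qcos_zero q) = 0" using m m0 by (simp_all add: zero Z_def)
  have pos: "0 < rcos q x" if "0 \<le> x" "x < m" for x
  proof (rule ccontr)
    assume "\<not> 0 < rcos q x"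
    then have "\<exists>t\<ge>0. t \<le> x \<and> rcos q t = 0"
      using that by (intro IVT2) (auto simp: rcos_0 isCont_rcos)
    then obtain t where "0 \<le> t" "t \<le> x" "rcos q t = 0" by blast
    then show False using least[of t] that rcos_0 by (cases "t = 0") auto
  qed
  show "0 < rcos q x" if "\<bar>x\<bar> < qcos_zero q"
    using that pos[of x] pos[of "- x"] rcos_minus[of x] by (cases "0 \<le> x") (auto simp: zero)
qed

section \<open>The inverse of the tangent up to the first zero of the cosine\<close>

lemma qtan_of_real: "qtan q (of_real x) = of_real (rsin q x / rcos q x)"
  by (simp add: qtan_def qcos_of_real qsin_of_real)

lemma rtan_inj:
  assumes "x \<in> {0..<qcos_zero q}" "y \<in> {0..<qcos_zero q}" "rsin q x / rcos q x = rsin q y / rcos q y"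
  shows "x = y"
proof (rule ccontr)
  have less: "rsin q a / rcos q a < rsin q b / rcos q b" if "0 \<le> a" "a < b" "b < qcos_zero q" for a b
    using that by (intro rtan_strict_mono rcos_pos) auto
  assume "x \<noteq> y"
  then show False
    using less[of x y] less[of y x] assms by (cases "x < y") auto
qed

lemma rsin_pos:
  assumes "0 < x" "x < qcos_zero q" shows "0 < rsin q x"
proof -
  have "rsin q 0 / rcos q 0 < rsin q x / rcos q x"
    using assms by (intro rtan_strict_mono rcos_pos) auto
  moreover have "0 < rcos q x" using assms by (intro rcos_pos) auto
  ultimately show ?thesis by (simp add: rsin_0 zero_less_divide_iff)
qed

text \<open>The tangent is unbounded at the first zero of the cosine. After clearing the
  denominator, \<open>rsin q x - y * rcos q x\<close> is continuous on the closed interval and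
  changes sign there.\<close>

lemma
  assumes y: "0 < y"
  shows qarctan_pos: "0 < qarctan q y" and qarctan_less: "qarctan q y < qcos_zero q"
    and qarctan_eq: "rsin q (qarctan q y) = y * rcos q (qarctan q y)"
proof -
  define b where "b = qcos_zero q"
  have b: "0 < b" "rcos q b = 0" using qcos_zero_pos rcos_qcos_zero by (simp_all add: b_def)
  \<comment> \<open>To the left of \<open>b\<close> the sine is positive, so by continuity it cannot
    be negative at \<open>b\<close>.\<close>
  have "0 \<le> rsin q b"
  proof (rule ccontr)
    assume "\<not> 0 \<le> rsin q b"
    moreover have "rsin q \<midarrow>b\<rightarrow> rsin q b" using isCont_rsin[of b] by (simp only: isCont_def)
    ultimately have "\<forall>\<^sub>F x in at b. rsin q x < 0" by (intro order_tendstoD(2)) auto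
    then have "\<forall>\<^sub>F x in at_left b. rsin q x < 0" by (rule filter_leD[OF at_le[OF subset_UNIV]])
    moreover have "\<forall>\<^sub>F x in at_left b. 0 < rsin q x"
      using eventually_at_left_real[OF b(1)]
    proof eventually_elim
      case (elim x)
      then show ?case by (intro rsin_pos) (simp_all add: b_def)
    qed
    ultimately have "\<forall>\<^sub>F x in at_left b. False" by eventually_elim simp
    then show False by simp
  qed
  have cont: "isCont (\<lambda>x. rsin q x - y * rcos q x) x" for x
    by (intro continuous_diff continuous_mult continuous_const isCont_rcos isCont_rsin)
  have "\<exists>x\<ge>0. x \<le> b \<and> rsin q x - y * rcos q x = 0"
  proof (rule IVT[of "\<lambda>x. rsin q x - y * rcos q x"])
    show "rsin q 0 - y * rcos q 0 \<le> 0" using y by (simp add: rsin_0 rcos_0)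
    show "0 \<le> rsin q b - y * rcos q b" using \<open>0 \<le> rsin q b\<close> b(2) by simp
  qed (use b(1) cont in auto)
  then obtain x where x: "0 \<le> x" "x \<le> b" "rsin q x = y * rcos q x"
    by (metis eq_iff_diff_eq_0)
  \<comment> \<open>Cosine and sine have no common real zero, because \<open>qexp q\<close> has no
    zero on the imaginary axis. This excludes the endpoint \<open>b\<close>.\<close>
  have "rsin q b \<noteq> 0"
    using qexp_nonzero[OF q, of "\<i> * of_real b"] b(2) by (simp add: rcos_def rsin_def complex_eq_iff)
  then have "x \<noteq> b" using b(2) x(3) by force
  moreover have "x \<noteq> 0"
  proof
    assume "x = 0"
    then show False using x(3) y by (simp add: rsin_0 rcos_0)
  qed
  ultimately have x': "0 < x" "x < b" using x(1,2) by auto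
  have "qarctan q y = x"
    unfolding qarctan_def
  proof (rule the_inv_into_f_eq)
    show "inj_on (\<lambda>x. qtan q (of_real x)) {0..<qcos_zero q}"
      by (rule inj_onI, rule rtan_inj) (simp_all only: qtan_of_real of_real_eq_iff)
    show "qtan q (of_real x) = of_real y"
    proof -
      have "0 < rcos q x" using x' by (intro rcos_pos) (simp add: b_def)
      then show ?thesis by (simp add: qtan_of_real x(3))
    qed
    show "x \<in> {0..<qcos_zero q}" using x' by (simp add: b_def)
  qed
  then show "0 < qarctan q y" "qarctan q y < qcos_zero q" "rsin q (qarctan q y) = y * rcos q (qarctan q y)"
    using x' x(3) by (simp_all only: b_def)
qed

text \<open>In terms of \<open>P\<close> and \<open>N\<close> the equation reads
  \<open>(1 + \<i> * s) * P = - (1 - \<i> * s) * N\<close>. The coefficients are conjugate up to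
  sign, so \<open>norm P = norm N\<close>, which \<open>norm_qexp_minus_less\<close> excludes off
  the real axis.\<close>

lemma qcos_eq_qsin_imp_real:
  assumes "qcos q z = of_real s * qsin q z" shows "Im z = 0"
proof -
  define P N where "P = qexp q (\<i> * z)" and "N = qexp q (- (\<i> * z))"
  have "\<i> * (P + N) = of_real s * (P - N)"
  proof -
    have "(P + N) / 2 = of_real s * ((P - N) / (2 * \<i>))"
      using assms q by (simp add: qcos_qexp qsin_qexp P_def N_def)
    then have "2 * \<i> * ((P + N) / 2) = 2 * \<i> * (of_real s * ((P - N) / (2 * \<i>)))"
      by (rule arg_cong)
    also have "\<dots> = of_real s * (P - N)"
      by (simp only: mult.left_commute[of "2 * \<i>"]) simp
    finally show ?thesis by simp
  qed
  moreover have "(1 + \<i> * of_real s) * P + (1 - \<i> * of_real s) * N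
      = - \<i> * (\<i> * (P + N) - of_real s * (P - N))"
    by (simp add: algebra_simps)
  ultimately have "(1 + \<i> * of_real s) * P = - ((1 - \<i> * of_real s) * N)"
    by (simp add: eq_neg_iff_add_eq_0)
  then have "norm ((1 + \<i> * of_real s) * P) = norm ((1 - \<i> * of_real s) * N)"
    by (metis norm_minus_cancel)
  moreover have "norm (1 + \<i> * of_real s) = norm (1 - \<i> * of_real s)" "1 + \<i> * of_real s \<noteq> 0"
    by (simp_all add: cmod_def complex_eq_iff)
  ultimately have "norm P = norm N"
    by (simp add: norm_mult)
  then show ?thesis
    unfolding P_def N_def using norm_qexp_minus_less[OF q, of "\<i> * z"] norm_qexp_minus_less[OF q, of "- (\<i> * z)"]
    by (cases "Im z" "0::real" rule: linorder_cases) auto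
qed

text \<open>In this disc a real solution has positive cosine, hence positive sine, and is therefore
  positive since the sine is odd. On that range the tangent is injective.\<close>

lemma qcos_eq_qsin_unique:
  assumes s: "0 < s" and eq: "qcos q z = of_real s * qsin q z" and z: "norm z < qcos_zero q"
  shows "z = of_real (qarctan q (1 / s))"
proof -
  have zr: "z = of_real (Re z)" using qcos_eq_qsin_imp_real[OF eq] by (simp add: complex_eq_iff)
  define x where "x = Re z"
  have x: "\<bar>x\<bar> < qcos_zero q" using z zr by (metis norm_of_real x_def)
  have eqx: "rcos q x = s * rsin q x"
    using eq zr unfolding x_def by (metis qcos_of_real qsin_of_real of_real_eq_iff of_real_mult)
  have pos: "0 < rcos q x" by (rule rcos_pos[OF x])
  have "0 < rsin q x" using pos s eqx by (simp add: zero_less_mult_iff)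
  then have "0 < x"
    using rsin_pos[of "- x"] x rsin_minus[of x] rsin_0 by (cases x "0::real" rule: linorder_cases) auto
  define y where "y = qarctan q (1 / s)"
  have "0 < 1 / s" using s by simp
  then have y: "0 < y" "y < qcos_zero q" "rsin q y = 1 / s * rcos q y"
    unfolding y_def by (rule qarctan_pos qarctan_less qarctan_eq)+
  have "0 < rcos q y" using y by (intro rcos_pos) simp
  have "x = y"
  proof (rule rtan_inj)
    show "x \<in> {0..<qcos_zero q}" "y \<in> {0..<qcos_zero q}" using x \<open>0 < x\<close> y by auto
    have "rsin q x / rcos q x = 1 / s" using eqx s \<open>0 < rsin q x\<close> by simp
    also have "\<dots> = rsin q y / rcos q y" using y(3) \<open>0 < rcos q y\<close> by simp
    finally show "rsin q x / rcos q x = rsin q y / rcos q y" .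
  qed
  then show ?thesis using zr by (simp add: x_def y_def)
qed

end


section \<open>Duality between $q$ and $1/q$\<close>

text \<open>The functional equation for \<open>1 / q\<close> splits off from
  \<open>qexp (1 / q) (- z)\<close> the very factors whose inverses make up \<open>qexp q z\<close>;
  what remains tends to \<open>qexp (1 / q) 0 = 1\<close>. At the excluded poles the convention for
  \<open>1 / 0\<close> would make the product \<open>0\<close>.\<close>

lemma qexp_inverse:
  assumes q: "0 < q" "q < 1" and z: "\<And>n. z * of_real ((1 - q) * q ^ n) \<noteq> 1"
  shows "qexp q z * qexp (1 / q) (- z) = 1"
proof -
  define f where "f n = 1 - z * of_real ((1 - q) * q ^ n)" for n
  define E where "E = qexp (1 / q)"
  have q': "1 < 1 / q" using q by simp
  have fnz: "f n \<noteq> 0" for n using z[of n] by (simp add: f_def)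
  have step: "E x = (1 + of_real (1 - q) * x) * E (of_real q * x)" for x
    using qexp_mult_q[OF q', of "of_real q * x"] q
    by (simp add: E_def field_simps del: of_real_diff)
  have iter: "E (- z) = (\<Prod>k<n. f k) * E (- z * of_real (q ^ n))" for n
  proof (induction n)
    case (Suc n)
    then show ?case
      using step[of "- z * of_real (q ^ n)"] by (simp add: f_def mult_ac)
  qed simp
  have "summable (\<lambda>n. norm (f n - 1))"
  proof -
    have "summable (\<lambda>n. norm z * (1 - q) * q ^ n)"
      using q by (intro summable_mult summable_geometric) auto
    then show ?thesis
      using q by (simp add: f_def norm_mult norm_power abs_mult mult_ac
                       del: of_real_diff of_real_power of_real_mult)
  qed
  then have "convergent_prod f"
    by (intro abs_convergent_prod_imp_convergent_prod summable_imp_abs_convergent_prod)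
  then have conv: "convergent_prod (\<lambda>n. inverse (f n))"
    by (rule convergent_prod_inverse)
  have "(\<lambda>n. \<Prod>i<n. inverse (f i)) \<longlonglongrightarrow> qexp q z"
  proof (rule LIMSEQ_imp_Suc)
    have "prodinf (\<lambda>n. inverse (f n)) = qexp q z"
      using q by (simp add: qexp_def f_def inverse_eq_divide)
    then show "(\<lambda>n. \<Prod>i<Suc n. inverse (f i)) \<longlonglongrightarrow> qexp q z"
      using convergent_prod_LIMSEQ[OF conv] by (simp only: lessThan_Suc_atMost)
  qed
  then have "(\<lambda>n. (\<Prod>i<n. inverse (f i)) * E (- z)) \<longlonglongrightarrow> qexp q z * E (- z)"
    by (intro tendsto_intros)
  moreover have "(\<Prod>i<n. inverse (f i)) * E (- z) = E (- z * of_real (q ^ n))" for n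
    using fnz by (subst iter[of n]) (simp add: mult.assoc[symmetric] prod.distrib[symmetric])
  moreover have "(\<lambda>n. E (- z * of_real (q ^ n))) \<longlonglongrightarrow> E (- z * of_real 0)"
    using q q' unfolding E_def
    by (intro isCont_tendsto_compose[OF isCont_qexp] tendsto_intros LIMSEQ_power_zero) auto
  ultimately have "qexp q z * E (- z) = E (- z * of_real 0)"
    using LIMSEQ_unique by simp
  then show ?thesis using q by (simp add: E_def)
qed

text \<open>
  The factor by which \<open>qcos\<close> and \<open>qsin\<close> for a parameter \<open>q < 1\<close> differ from the entire functions
  for \<open>1 / q\<close>. It cancels in \<open>h / g\<close>, and with it go the poles on the imaginary axis.
\<close>

definition qdual :: "real \<Rightarrow> complex \<Rightarrow> complex" where
  "qdual q z = (if q < 1 then 1 / (qexp (1 / q) (\<i> * z) * qexp (1 / q) (- \<i> * z)) else 1)"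

text \<open>For \<open>q < 1\<close> the two exponentials become \<open>1 / N\<close> and
  \<open>1 / P\<close>. Their sum and difference are \<open>P + N\<close> and \<open>P - N\<close>
  over \<open>P * N\<close>, so cosine and sine acquire the same factor. The poles lie on the
  imaginary axis at distance at least \<open>1 / (1 - q)\<close> from \<open>0\<close>, hence the
  condition on \<open>z\<close>.\<close>

lemma
  assumes q: "0 < q" and z: "Re z \<noteq> 0 \<or> norm z * (1 - q) < 1"
  shows qcos_dual: "qcos q z = qdual q z * qcos (max q (1 / q)) z"
    and qsin_dual: "qsin q z = qdual q z * qsin (max q (1 / q)) z"
    and qdual_nonzero: "qdual q z \<noteq> 0"
proof -
  have "qcos q z = qdual q z * qcos (max q (1 / q)) z \<and> qsin q z = qdual q z * qsin (max q (1 / q)) z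
      \<and> qdual q z \<noteq> 0"
  proof (cases "q < 1")
    case False
    then have "max q (1 / q) = q" using q by (simp add: max_def field_simps) (smt (verit) mult_le_cancel_left1)
    then show ?thesis using False by (simp add: qdual_def)
  next
    case True
    have "1 < 1 / q" using q True by simp
    then have mx: "max q (1 / q) = 1 / q" using True by linarith
    have ne: "(c * z) * of_real ((1 - q) * q ^ n) \<noteq> 1" if c: "c = \<i> \<or> c = - \<i>" for c n
    proof
      assume eq: "(c * z) * of_real ((1 - q) * q ^ n) = 1"
      have "Im ((c * z) * of_real ((1 - q) * q ^ n)) = 0" unfolding eq by simp
      then have "Re z = 0" using c q True by auto
      have "norm ((c * z) * of_real ((1 - q) * q ^ n)) = 1" unfolding eq by simp
      then have "norm z * (1 - q) * q ^ n = 1"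
        using c q True by (auto simp: norm_mult norm_power abs_mult mult_ac
                       simp del: of_real_diff of_real_power of_real_mult)
      moreover have "norm z * (1 - q) * q ^ n \<le> norm z * (1 - q) * 1"
        using q True by (intro mult_left_mono power_le_one) auto
      ultimately show False using \<open>Re z = 0\<close> z by simp
    qed
    define P N where "P = qexp (1 / q) (\<i> * z)" and "N = qexp (1 / q) (- \<i> * z)"
    have inv: "qexp q (c * z) * qexp (1 / q) (- (c * z)) = 1" if "c = \<i> \<or> c = - \<i>" for c
      using ne[OF that] by (rule qexp_inverse[OF q True])
    have "qexp q (\<i> * z) * N = 1" "qexp q (- \<i> * z) * P = 1"
      using inv[of \<i>] inv[of "- \<i>"] by (simp_all add: P_def N_def)
    then have "P \<noteq> 0" "N \<noteq> 0" "qexp q (\<i> * z) = 1 / N" "qexp q (- \<i> * z) = 1 / P"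
      by (auto simp: divide_simps)
    then show ?thesis
      using q True \<open>1 < 1 / q\<close>
      by (simp only: mx qcos_qexp[of q] qsin_qexp[of q] qcos_qexp[of "1 / q"] qsin_qexp[of "1 / q"] qdual_def
          P_def[symmetric] N_def[symmetric]) (simp add: field_simps)
  qed
  then show "qcos q z = qdual q z * qcos (max q (1 / q)) z" "qsin q z = qdual q z * qsin (max q (1 / q)) z"
    "qdual q z \<noteq> 0" by auto
qed

lemma qdual_differentiable:
  assumes q: "0 < q" and z: "Re z \<noteq> 0" shows "qdual q field_differentiable at z"
proof (cases "q < 1")
  case False
  then show ?thesis by (simp add: qdual_def[abs_def])
next
  case True
  have q': "1 \<le> 1 / q" using q True by simp
  have diff: "(\<lambda>z. qexp (1 / q) (c * z)) field_differentiable at z" for c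
    using DERIV_chain2[OF qexp_field_derivative[OF q'], of "\<lambda>z. c * z" c z] 
    by (auto simp: field_differentiable_def intro!: derivative_eq_intros exI)
  moreover have "qdual q z \<noteq> 0" using qdual_nonzero[OF q] z by blast
  ultimately show ?thesis
    using True diff[of "- \<i>"] unfolding qdual_def[abs_def] if_P[OF True]
    by (intro field_differentiable_divide field_differentiable_mult field_differentiable_const) auto
qed

lemma qarctan_dual:
  assumes q: "0 < q" shows "qarctan q y = qarctan (max q (1 / q)) y"
proof -
  \<comment> \<open>A real \<open>x\<close> either is off the imaginary axis or equals
    \<open>0\<close>, so the duality holds on the whole real line.\<close>
  have z: "Re (of_real x) \<noteq> 0 \<or> norm (complex_of_real x) * (1 - q) < 1" for x by simp
  have "qcos q (of_real x) = 0 \<longleftrightarrow> qcos (max q (1 / q)) (of_real x) = 0" for x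
    unfolding qcos_dual[OF q z] using qdual_nonzero[OF q z] by simp
  then have "qcos_zero q = qcos_zero (max q (1 / q))" by (simp add: qcos_zero_def)
  moreover have "qtan q (of_real x) = qtan (max q (1 / q)) (of_real x)" for x
    unfolding qtan_def qcos_dual[OF q z] qsin_dual[OF q z] using qdual_nonzero[OF q z] by simp
  ultimately show ?thesis by (simp add: qarctan_def)
qed

section \<open>Parity, holomorphy and simplicity of the zeros\<close>

lemma qcos_minus:
  assumes "0 < q" shows "qcos q (- z) = qcos q z"
  unfolding qcos_qexp[OF assms] by (simp add: add.commute)

lemma qsin_minus:
  assumes "0 < q" shows "qsin q (- z) = - qsin q z"
  unfolding qsin_qexp[OF assms] minus_divide_left by simp

lemma holomorphic_qcos [holomorphic_intros]:
  assumes "1 \<le> q" "f holomorphic_on A" shows "(\<lambda>z. qcos q (f z)) holomorphic_on A"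
proof -
  have hol: "(\<lambda>z. qexp q (c * f z)) holomorphic_on A" for c
    using holomorphic_on_compose[OF holomorphic_on_mult[OF holomorphic_on_const assms(2)] holomorphic_qexp[OF assms(1)]]
    by (simp add: o_def)
  then show ?thesis
    using assms(1) hol[of "- \<i>"] by (subst qcos_qexp) (auto intro!: holomorphic_intros)
qed

lemma holomorphic_qsin [holomorphic_intros]:
  assumes "1 \<le> q" "f holomorphic_on A" shows "(\<lambda>z. qsin q (f z)) holomorphic_on A"
proof -
  have hol: "(\<lambda>z. qexp q (c * f z)) holomorphic_on A" for c
    using holomorphic_on_compose[OF holomorphic_on_mult[OF holomorphic_on_const assms(2)] holomorphic_qexp[OF assms(1)]]
    by (simp add: o_def)
  then show ?thesis
    using assms(1) hol[of "- \<i>"] by (subst qsin_qexp) (auto intro!: holomorphic_intros)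
qed

text \<open>If the derivative vanished, the derivatives of cosine and sine along the real line would
  have the same ratio \<open>s\<close> as their values, and the Wronskian would be
  \<open>0\<close>.\<close>

lemma deriv_qcos_diff_qsin_nonzero:
  assumes q: "1 \<le> q" and s: "0 < s" and x: "rcos q x = s * rsin q x"
  shows "deriv (\<lambda>z. qcos q z - of_real s * qsin q z) (of_real x) \<noteq> 0"
proof
  define F where "F = (\<lambda>z. qcos q z - of_real s * qsin q z)"
  define d where "d = \<i> * deriv (qexp q) (\<i> * of_real x)"
  assume "deriv (\<lambda>z. qcos q z - of_real s * qsin q z) (of_real x) = 0"
  moreover have "F holomorphic_on UNIV"
    unfolding F_def using q by (intro holomorphic_intros) auto
  ultimately have "(F has_field_derivative 0) (at (of_real x))"
    using holomorphic_derivI[of F UNIV "of_real x"] by (simp add: F_def)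
  then have "((\<lambda>t. F (of_real t)) has_vector_derivative 0) (at x)"
    by (rule has_vector_derivative_real_field)
  then have "((\<lambda>t. Re (F (of_real t))) has_real_derivative 0) (at x)"
    using has_field_derivative_Re by fastforce
  moreover have "Re (F (of_real t)) = rcos q t - s * rsin q t" for t
    using q by (simp add: F_def qcos_of_real qsin_of_real)
  moreover have "((\<lambda>t. rcos q t - s * rsin q t) has_real_derivative Re d - s * Im d) (at x)"
    unfolding d_def using rcos_derivative[OF q] rsin_derivative[OF q]
    by (intro DERIV_diff DERIV_cmult)
  ultimately have "Re d = s * Im d" using DERIV_unique by fastforce
  then show False
    using wronskian_pos[OF q, of x] x unfolding d_def by simp
qed


section \<open>Persistence and the transfer operator\<close>

text \<open>One step of the chain seen from its start \<open>x\<close>. Its \<open>n\<close>-th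
  iterate on the constant \<open>1\<close> is the probability, given the start, that the next
  \<open>n\<close> constraints hold.\<close>

definition transfer_op :: "real measure \<Rightarrow> real \<Rightarrow> (real \<Rightarrow> real) \<Rightarrow> real \<Rightarrow> real" where
  "transfer_op \<mu> \<theta> f x = (\<integral>y. (if \<theta> * x < y then f y else 0) \<partial>\<mu>)"

locale real_prob_measure = prob_space \<mu> for \<mu> :: "real measure" +
  assumes sets_mu [simp, measurable_cong]: "sets \<mu> = sets borel"
begin

lemma space_mu [simp]: "space \<mu> = UNIV"
  using sets_eq_imp_space_eq[OF sets_mu] by simp

lemma integrable_unit:
  assumes "f \<in> borel_measurable borel" "\<And>x. 0 \<le> f x \<and> f x \<le> (1::real)" shows "integrable \<mu> f"
  using assms by (intro integrable_const_bound[where B = 1]) auto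

lemma integral_unit:
  assumes "f \<in> borel_measurable borel" "\<And>x. 0 \<le> f x \<and> f x \<le> (1::real)"
  shows "0 \<le> integral\<^sup>L \<mu> f \<and> integral\<^sup>L \<mu> f \<le> 1"
  using assms by (auto intro!: integral_nonneg_AE integral_le_const integrable_unit)

lemma transfer_op_measurable [measurable]:
  assumes [measurable]: "f \<in> borel_measurable borel"
  shows "transfer_op \<mu> \<theta> f \<in> borel_measurable borel"
proof -
  have "(\<lambda>(x, y). if \<theta> * x < y then f y else 0) \<in> borel_measurable (borel \<Otimes>\<^sub>M \<mu>)"
    by measurable
  then show ?thesis
    unfolding transfer_op_def[abs_def] by (rule borel_measurable_lebesgue_integral)
qed

lemma transfer_op_unit:
  assumes [measurable]: "f \<in> borel_measurable borel" and "\<And>x. 0 \<le> f x \<and> f x \<le> 1"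
  shows "0 \<le> transfer_op \<mu> \<theta> f x \<and> transfer_op \<mu> \<theta> f x \<le> 1"
  unfolding transfer_op_def using assms(2) by (intro integral_unit) auto

lemma transfer_op_funpow:
  assumes "f \<in> borel_measurable borel" "\<And>x. 0 \<le> f x \<and> f x \<le> 1"
  shows "(transfer_op \<mu> \<theta> ^^ n) f \<in> borel_measurable borel"
    and "0 \<le> (transfer_op \<mu> \<theta> ^^ n) f x \<and> (transfer_op \<mu> \<theta> ^^ n) f x \<le> 1"
proof -
  have "(transfer_op \<mu> \<theta> ^^ n) f \<in> borel_measurable borel \<and>
    (\<forall>x. 0 \<le> (transfer_op \<mu> \<theta> ^^ n) f x \<and> (transfer_op \<mu> \<theta> ^^ n) f x \<le> 1)"
    by (induction n) (use assms transfer_op_unit in \<open>auto simp: transfer_op_measurable\<close>)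
  then show "(transfer_op \<mu> \<theta> ^^ n) f \<in> borel_measurable borel"
    "0 \<le> (transfer_op \<mu> \<theta> ^^ n) f x \<and> (transfer_op \<mu> \<theta> ^^ n) f x \<le> 1" by auto
qed

text \<open>A general \<open>f\<close> at the last coordinate makes the induction work: integrating
  out coordinate \<open>n + 2\<close> replaces \<open>f\<close> by
  \<open>transfer_op \<mu> \<theta> f\<close> at coordinate \<open>n + 1\<close>.\<close>

lemma integral_chain:
  assumes "f \<in> borel_measurable borel" and "\<And>x. 0 \<le> f x \<and> f x \<le> 1"
  shows "(\<integral>v. (if \<forall>k\<in>{1..n}. \<theta> * v k < v (k + 1) then f (v (n + 1)) else 0)
            \<partial>(\<Pi>\<^sub>M i\<in>{1..n + 1}. \<mu>)) = (\<integral>x. (transfer_op \<mu> \<theta> ^^ n) f x \<partial>\<mu>)"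
  using assms
proof (induction n arbitrary: f)
  case 0
  interpret product_sigma_finite "\<lambda>_::nat. \<mu>" ..
  have "{1..0 + 1} = {1::nat}" by auto
  then show ?case
    using product_integral_singleton[of f 1] 0 by simp
next
  case (Suc n)
  note prob = prob_space_axioms
  interpret product_prob_space "\<lambda>_::nat. \<mu>" ..
  note [measurable] = Suc.prems(1)
  let ?C = "\<lambda>v. \<forall>k\<in>{1..n}. \<theta> * v k < v (k + 1)"
  let ?g = "\<lambda>v. if \<forall>k\<in>{1..Suc n}. \<theta> * v k < v (k + 1) then f (v (Suc n + 1)) else 0"
  have ins: "{1..Suc n + 1} = insert (n + 2) {1..n + 1}" by auto
  interpret Pi: prob_space "\<Pi>\<^sub>M i\<in>insert (n + 2) {1..n + 1}. \<mu>"
    by (intro prob_space_PiM prob)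
  have [measurable]: "(\<lambda>v. v k) \<in> borel_measurable (\<Pi>\<^sub>M i\<in>insert (n + 2) {1..n + 1}. \<mu>)"
    if "k \<in> insert (n + 2) {1..n + 1}" for k
    using measurable_component_singleton[OF that, of "\<lambda>_. \<mu>"]
    by (simp only: measurable_cong_sets[OF refl sets_mu])
  have "integrable (\<Pi>\<^sub>M i\<in>insert (n + 2) {1..n + 1}. \<mu>) ?g"
  proof (rule Pi.integrable_const_bound[where B = 1])
    show "?g \<in> borel_measurable (\<Pi>\<^sub>M i\<in>insert (n + 2) {1..n + 1}. \<mu>)"
      by measurable auto
  qed (use Suc.prems(2) in auto)
  then have "(\<integral>v. ?g v \<partial>(\<Pi>\<^sub>M i\<in>{1..Suc n + 1}. \<mu>))
      = (\<integral>v. (\<integral>y. ?g (v(n + 2 := y)) \<partial>\<mu>) \<partial>(\<Pi>\<^sub>M i\<in>{1..n + 1}. \<mu>))"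
    unfolding ins by (intro product_integral_insert) auto
  also have "\<dots> = (\<integral>v. (if ?C v then transfer_op \<mu> \<theta> f (v (n + 1)) else 0) \<partial>(\<Pi>\<^sub>M i\<in>{1..n + 1}. \<mu>))"
  proof (rule Bochner_Integration.integral_cong[OF refl])
    fix v :: "nat \<Rightarrow> real"
    have "{1..Suc n} = insert (n + 1) {1..n}" by auto
    then have "(\<forall>k\<in>{1..Suc n}. \<theta> * (v(n + 2 := y)) k < (v(n + 2 := y)) (k + 1))
        \<longleftrightarrow> ?C v \<and> \<theta> * v (n + 1) < y" for y
      by auto
    then have eq: "?g (v(n + 2 := y)) = (if ?C v then if \<theta> * v (n + 1) < y then f y else 0 else 0)" for y
      by (simp only: fun_upd_same if_if_eq_conj) simp
    then show "(\<integral>y. ?g (v(n + 2 := y)) \<partial>\<mu>) = (if ?C v then transfer_op \<mu> \<theta> f (v (n + 1)) else 0)"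
    proof (cases "?C v")
      case True
      show ?thesis by (simp only: eq transfer_op_def if_P[OF True])
    next
      case False
      show ?thesis by (simp only: eq if_not_P[OF False] Bochner_Integration.integral_zero)
    qed
  qed
  also have "\<dots> = (\<integral>x. (transfer_op \<mu> \<theta> ^^ n) (transfer_op \<mu> \<theta> f) x \<partial>\<mu>)"
    using Suc.prems by (intro Suc.IH transfer_op_measurable transfer_op_unit)
  finally show ?case by (simp add: funpow_swap1)
qed

end

text \<open>Only \<open>X 1, ..., X (n + 1)\<close> enter, and independence makes their joint law
  the product measure of \<open>integral_chain\<close>.\<close>

lemma persistence_eq_integral:
  assumes "prob_space M" and indep: "prob_space.indep_vars M (\<lambda>_. borel) X UNIV"
    and "real_prob_measure \<mu>" and distr: "\<And>i. distr M borel (X i) = \<mu>"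
  shows "persistence M X \<theta> n = (\<integral>x. (transfer_op \<mu> \<theta> ^^ n) (\<lambda>_. 1) x \<partial>\<mu>)"
proof -
  interpret M: prob_space M by fact
  interpret real_prob_measure \<mu> by fact
  let ?I = "{1..n + 1}"
  let ?C = "\<lambda>v. \<forall>k\<in>{1..n}. \<theta> * v k < v (k + 1)"
  let ?P = "\<Pi>\<^sub>M i\<in>?I. \<mu>"
  have rv [measurable]: "X i \<in> borel_measurable M" for i
    using indep by (simp add: M.indep_vars_def)
  have "M.indep_vars (\<lambda>_. borel) X ?I"
    using indep by (rule M.indep_vars_subset) simp
  then have D: "distr M (\<Pi>\<^sub>M i\<in>?I. borel) (\<lambda>\<omega>. \<lambda>i\<in>?I. X i \<omega>) = ?P"
    using M.indep_vars_iff_distr_eq_PiM'[of ?I X "\<lambda>_. borel"] rv by (simp add: distr)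
  have comp [measurable]: "(\<lambda>v. v k) \<in> borel_measurable (\<Pi>\<^sub>M i\<in>?I. borel :: real measure)" if "k \<in> ?I" for k
    using measurable_component_singleton[OF that, of "\<lambda>_. borel"] by simp
  have C: "{v \<in> space (\<Pi>\<^sub>M i\<in>?I. borel). ?C v} \<in> sets (\<Pi>\<^sub>M i\<in>?I. borel :: real measure)"
    by measurable
  have sets: "sets ?P = sets (\<Pi>\<^sub>M i\<in>?I. borel :: real measure)"
    by (intro sets_PiM_cong) auto
  interpret Pi: prob_space ?P by (intro prob_space_PiM prob_space_axioms)
  have "persistence M X \<theta> n = measure M ((\<lambda>\<omega>. \<lambda>i\<in>?I. X i \<omega>) -` {v \<in> space (\<Pi>\<^sub>M i\<in>?I. borel). ?C v} \<inter> space M)"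
    unfolding persistence_def
    by (intro arg_cong[where f = "measure M"]) (auto simp: space_PiM)
  also have "\<dots> = measure (distr M (\<Pi>\<^sub>M i\<in>?I. borel) (\<lambda>\<omega>. \<lambda>i\<in>?I. X i \<omega>)) {v \<in> space (\<Pi>\<^sub>M i\<in>?I. borel). ?C v}"
    using C by (subst measure_distr) auto
  also have "\<dots> = measure ?P {v \<in> space ?P. ?C v}"
    unfolding D using sets_eq_imp_space_eq[OF sets] by simp
  also have "\<dots> = (\<integral>v. (if ?C v then 1 else 0) \<partial>?P)"
  proof -
    have "{v \<in> space ?P. ?C v} \<in> sets ?P"
      using C sets sets_eq_imp_space_eq[OF sets] by simp
    then have "measure ?P {v \<in> space ?P. ?C v} = (\<integral>v. indicator {v \<in> space ?P. ?C v} v \<partial>?P)"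
      by simp
    also have "\<dots> = (\<integral>v. (if ?C v then 1 else 0) \<partial>?P)"
      by (intro Bochner_Integration.integral_cong) (auto simp: indicator_def)
    finally show ?thesis .
  qed
  also have "\<dots> = (\<integral>x. (transfer_op \<mu> \<theta> ^^ n) (\<lambda>_. 1) x \<partial>\<mu>)"
    using integral_chain[of "\<lambda>_. 1"] by simp
  finally show ?thesis .
qed


section \<open>The generating function for Laplace increments\<close>

lemma has_bochner_integral_exp_halfline:
  fixes c t :: real
  assumes c: "0 < c"
  shows "has_bochner_integral lborel (\<lambda>s. indicator {t<..} s * exp (- c * s)) (exp (- c * t) / c)"
proof -
  have lim: "((\<lambda>s. - (exp (- c * s) / c)) \<longlongrightarrow> 0) at_top"
    using c by real_asymp
  have "(\<integral>\<^sup>+s. ennreal (indicator {t<..} s * exp (- c * s)) \<partial>lborel)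
      = (\<integral>\<^sup>+s. ennreal (exp (- c * s)) * indicator {t..} s \<partial>lborel)"
    using AE_lborel_singleton[of t]
    by (intro nn_integral_cong_AE) (auto elim!: eventually_mono simp: indicator_def)
  also have "\<dots> = ennreal (0 - (- (exp (- c * t) / c)))"
    using c by (intro nn_integral_FTC_atLeast[OF _ _ _ lim]) (auto intro!: derivative_eq_intros)
  finally have *: "(\<integral>\<^sup>+s. ennreal (indicator {t<..} s * exp (- c * s)) \<partial>lborel) = ennreal (exp (- c * t) / c)"
    by simp
  show ?thesis
    using c by (intro has_bochner_integral_nn_integral[OF _ _ _ *]) auto
qed

text \<open>Unlike \<open>qnum\<close>, which is \<open>0\<close> at \<open>q = 1\<close> by division by zero, this is correct for all \<open>q\<close>.\<close>

definition qint :: "real \<Rightarrow> nat \<Rightarrow> real" where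
  "qint q k = (\<Sum>i<k. q ^ i)"

lemma qint_Suc: "qint q (Suc k) = 1 + q * qint q k"
  unfolding qint_def by (subst sum.lessThan_Suc_shift) (simp add: sum_distrib_left)

lemma qint_nonneg: "0 < q \<Longrightarrow> 0 \<le> qint q k"
  by (simp add: qint_def sum_nonneg)

lemma qfact_Suc_qint:
  assumes "0 < q" shows "qfact q (Suc n) = qint q (Suc n) * qfact q n"
proof (cases "q = 1")
  case False
  then have "qnum q (Suc n) = qint q (Suc n)"
    unfolding qnum_def qint_def by (subst geometric_sum) (auto simp: divide_simps algebra_simps)
  then show ?thesis using False by (simp add: qfact_Suc)
qed (simp add: qfact_Suc qint_def)

definition laplace_measure :: "real \<Rightarrow> real measure" where
  "laplace_measure \<xi> = density lborel (\<lambda>x. ennreal (laplace_density \<xi> x))"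

lemma laplace_density_measurable [measurable]: "laplace_density \<xi> \<in> borel_measurable borel"
  unfolding laplace_density_def[abs_def] by measurable

context
  fixes \<xi> q :: real and \<mu>
  assumes xi: "0 < \<xi>" "\<xi> < 1" and q: "0 < q"
    and mu: "\<mu> = laplace_measure \<xi>" and prob: "real_prob_measure \<mu>"
begin

interpretation real_prob_measure \<mu> by (rule prob)

lemma laplace_density_nonneg: "0 \<le> laplace_density \<xi> x"
  using xi by (simp add: laplace_density_def)

lemma integral_laplace:
  fixes f :: "real \<Rightarrow> real"
  assumes "f \<in> borel_measurable borel"
  shows "(\<integral>x. f x \<partial>\<mu>) = (\<integral>x. laplace_density \<xi> x * f x \<partial>lborel)"
  unfolding mu laplace_measure_def using assms laplace_density_nonneg
  by (subst integral_density) auto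

lemma transfer_op_nonpos:
  assumes [measurable]: "f \<in> borel_measurable borel" and x: "0 \<le> x"
  shows "transfer_op \<mu> (- q) f (- x) = (1 - \<xi>) * (\<integral>s. indicator {q * x<..} s * (exp (- s) * f s) \<partial>lborel)"
proof -
  have "0 \<le> q * x" using q x by simp
  have "transfer_op \<mu> (- q) f (- x) = (\<integral>y. laplace_density \<xi> y * (if q * x < y then f y else 0) \<partial>lborel)"
    unfolding transfer_op_def by (subst integral_laplace) auto
  also have "\<dots> = (\<integral>s. (1 - \<xi>) * (indicator {q * x<..} s * (exp (- s) * f s)) \<partial>lborel)"
    using \<open>0 \<le> q * x\<close>
    by (intro Bochner_Integration.integral_cong) (auto simp: laplace_density_def indicator_def)
  finally show ?thesis by simp
qed

text \<open>Here the threshold \<open>- q * x\<close> is at most \<open>0\<close>, so the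
  complementary event is integrated. The reflection \<open>s = - y\<close> brings it to the
  half-line of \<open>transfer_op_nonpos\<close>; this common range lets the two branches be
  combined.\<close>

lemma transfer_op_nonneg:
  assumes [measurable]: "f \<in> borel_measurable borel" and f: "\<And>x. 0 \<le> f x \<and> f x \<le> 1" and x: "0 \<le> x"
  shows "transfer_op \<mu> (- q) f x = (\<integral>y. f y \<partial>\<mu>)
     - \<xi> * (\<integral>s. indicator {q * x<..} s * (exp (- s) * f (- s)) \<partial>lborel)"
proof -
  have "0 \<le> q * x" using q x by simp
  have "(\<integral>y. f y \<partial>\<mu>) - transfer_op \<mu> (- q) f x
      = (\<integral>y. f y - (if - q * x < y then f y else 0) \<partial>\<mu>)"
    unfolding transfer_op_def using f
    by (intro Bochner_Integration.integral_diff[symmetric] integrable_unit) auto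
  also have "\<dots> = (\<integral>y. laplace_density \<xi> y * (f y - (if - q * x < y then f y else 0)) \<partial>lborel)"
    by (subst integral_laplace) auto
  also have "\<dots> = (\<integral>s. laplace_density \<xi> (- s) * (f (- s) - (if - q * x < - s then f (- s) else 0)) \<partial>lborel)"
    by (subst lborel_integral_real_affine[where c = "-1" and t = 0], simp) (simp only: abs_minus_cancel abs_one scaleR_one add_0 mult_minus1)
  also have "\<dots> = (\<integral>s. \<xi> * (indicator {q * x<..} s * (exp (- s) * f (- s))) \<partial>lborel)"
  \<comment> \<open>At \<open>s = q * x\<close> the sides may differ: the left one keeps
    \<open>f (- s)\<close>, the open half-line omits it.\<close>
  proof (rule integral_cong_AE)
    show "AE s in lborel. laplace_density \<xi> (- s) * (f (- s) - (if - q * x < - s then f (- s) else 0))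
        = \<xi> * (indicator {q * x<..} s * (exp (- s) * f (- s)))"
      using AE_lborel_singleton[of "q * x"]
      by eventually_elim (use \<open>0 \<le> q * x\<close> in \<open>auto simp: laplace_density_def indicator_def\<close>)
  qed auto
  finally show ?thesis by simp
qed

section \<open>The two branches as one complex function\<close>

definition chain_prob :: "nat \<Rightarrow> real \<Rightarrow> real" where
  "chain_prob n = (transfer_op \<mu> (- q) ^^ n) (\<lambda>_. 1)"

definition chain_integral :: "nat \<Rightarrow> real" where
  "chain_integral n = (\<integral>x. chain_prob n x \<partial>\<mu>)"

lemma chain_prob_measurable [measurable]: "chain_prob n \<in> borel_measurable borel"
  and chain_prob_unit: "0 \<le> chain_prob n x \<and> chain_prob n x \<le> 1"
  unfolding chain_prob_def by (intro transfer_op_funpow; simp)+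

lemma chain_integral_unit: "0 \<le> chain_integral n \<and> chain_integral n \<le> 1"
  unfolding chain_integral_def by (intro integral_unit chain_prob_measurable chain_prob_unit)

text \<open>The limit of \<open>chain_fun n x\<close> as \<open>x\<close> tends to infinity. For
  \<open>n > 0\<close>, a start at plus infinity voids the first constraint, which lowers the index
  by one; a start at minus infinity violates it, which leaves no imaginary part.\<close>

definition chain_coeff :: "nat \<Rightarrow> complex" where
  "chain_coeff n = (case n of 0 \<Rightarrow> of_real (sqrt (1 - \<xi>)) + \<i> * of_real (sqrt \<xi>)
                    | Suc m \<Rightarrow> of_real (sqrt (1 - \<xi>) * chain_integral m))"

text \<open>
  The coefficient of \<open>z ^ n\<close> in the solution of \<open>C'(x) = - \<i> z w q exp (- q x) C(q x)\<close>, where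
  \<open>w = sqrt (\<xi> * (1 - \<xi>))\<close>, whose value at infinity has the coefficients \<open>chain_coeff\<close>.
\<close>

definition chain_fun :: "nat \<Rightarrow> real \<Rightarrow> complex" where
  "chain_fun n x = (\<Sum>k\<le>n. chain_coeff (n - k) * (\<i> * of_real (sqrt (\<xi> * (1 - \<xi>)))) ^ k / of_real (qfact q k)
                      * of_real (exp (- (q * qint q k) * x)))"

text \<open>The differential equation in integrated form. Since
  \<open>1 + q * qint q k = qint q (Suc k)\<close>, integrating the \<open>k\<close>-th exponential
  over \<open>s > q * x\<close> yields the next one, and the division by
  \<open>qint q (Suc k)\<close> extends the \<open>q\<close>-factorial.\<close>

lemma chain_fun_Suc:
  defines "J \<equiv> \<lambda>n x. (\<integral>s. indicator {q * x<..} s *\<^sub>R (of_real (exp (- s)) * chain_fun n s) \<partial>lborel)"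
  shows "integrable lborel (\<lambda>s. indicator {q * x<..} s *\<^sub>R (of_real (exp (- s)) * chain_fun n s))"
    and "chain_fun (Suc n) x = chain_coeff (Suc n) + \<i> * of_real (sqrt (\<xi> * (1 - \<xi>))) * J n x"
proof -
  define w where "w = \<i> * complex_of_real (sqrt (\<xi> * (1 - \<xi>)))"
  define b where "b k = chain_coeff (n - k) * w ^ k / of_real (qfact q k)" for k
  have hbi: "has_bochner_integral lborel (\<lambda>s. \<Sum>k\<le>n. b k * of_real (indicator {q * x<..} s * exp (- qint q (Suc k) * s)))
        (\<Sum>k\<le>n. b k * of_real (exp (- qint q (Suc k) * (q * x)) / qint q (Suc k)))"
    using q qint_nonneg[OF q]
    by (intro has_bochner_integral_sum has_bochner_integral_mult_right has_bochner_integral_of_real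
        has_bochner_integral_exp_halfline) (auto simp: qint_Suc add_pos_nonneg)
  have eq: "indicator {q * x<..} s *\<^sub>R (of_real (exp (- s)) * chain_fun n s)
       = (\<Sum>k\<le>n. b k * of_real (indicator {q * x<..} s * exp (- qint q (Suc k) * s)))" for s
    unfolding chain_fun_def sum_distrib_left scaleR_sum_right w_def[symmetric]
  proof (rule sum.cong[OF refl])
    fix k
    have "exp (- qint q (Suc k) * s) = exp (- s) * exp (- (q * qint q k) * s)"
      by (simp add: qint_Suc algebra_simps flip: exp_add)
    then show "indicator {q * x<..} s *\<^sub>R (of_real (exp (- s)) * (chain_coeff (n - k) * w ^ k / of_real (qfact q k)
          * of_real (exp (- (q * qint q k) * s))))
        = b k * of_real (indicator {q * x<..} s * exp (- qint q (Suc k) * s))"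
      by (simp add: b_def scaleR_conv_of_real)
  qed
  show "integrable lborel (\<lambda>s. indicator {q * x<..} s *\<^sub>R (of_real (exp (- s)) * chain_fun n s))"
    unfolding eq using hbi by (simp only: has_bochner_integral_iff)
  have J: "J n x = (\<Sum>k\<le>n. b k * of_real (exp (- qint q (Suc k) * (q * x)) / qint q (Suc k)))"
    unfolding J_def eq using hbi by (rule has_bochner_integral_integral_eq)
  have "chain_fun (Suc n) x = chain_coeff (Suc n)
      + (\<Sum>k\<le>n. chain_coeff (n - k) * w ^ Suc k / of_real (qfact q (Suc k)) * of_real (exp (- (q * qint q (Suc k)) * x)))"
    unfolding chain_fun_def w_def[symmetric] by (subst sum.atMost_Suc_shift) (simp add: qint_def del: power_Suc sum.lessThan_Suc)
  also have "(\<Sum>k\<le>n. chain_coeff (n - k) * w ^ Suc k / of_real (qfact q (Suc k)) * of_real (exp (- (q * qint q (Suc k)) * x)))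
      = w * J n x"
    unfolding J sum_distrib_left
  proof (rule sum.cong[OF refl])
    fix k
    have "- (q * qint q (Suc k)) * x = - qint q (Suc k) * (q * x)" by simp
    then show "chain_coeff (n - k) * w ^ Suc k / of_real (qfact q (Suc k)) * of_real (exp (- (q * qint q (Suc k)) * x))
      = w * (b k * of_real (exp (- qint q (Suc k) * (q * x)) / qint q (Suc k)))"
      by (simp only: qfact_Suc_qint[OF q]) (simp add: b_def mult_ac)
  qed
  finally show "chain_fun (Suc n) x = chain_coeff (Suc n) + \<i> * of_real (sqrt (\<xi> * (1 - \<xi>))) * J n x"
    by (simp add: w_def)
qed

text \<open>Each branch at \<open>Suc n\<close> is an integral of the other one at \<open>n\<close>,
  so both are proved in one induction.\<close>

lemma chain_prob_chain_fun:
  assumes "0 \<le> x"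
  shows "sqrt (1 - \<xi>) * chain_prob n x = Re (chain_fun n x)"
    and "sqrt \<xi> * chain_prob n (- x) = Im (chain_fun n x)"
proof -
  define \<sigma> \<tau> where "\<sigma> = sqrt (1 - \<xi>)" and "\<tau> = sqrt \<xi>"
  have st: "\<sigma> * \<sigma> = 1 - \<xi>" "\<tau> * \<tau> = \<xi>" "sqrt (\<xi> * (1 - \<xi>)) = \<sigma> * \<tau>"
    using xi by (simp_all add: \<sigma>_def \<tau>_def real_sqrt_mult mult.commute)
  have "\<sigma> * chain_prob n x = Re (chain_fun n x) \<and> \<tau> * chain_prob n (- x) = Im (chain_fun n x)"
    using assms
  proof (induction n arbitrary: x)
    case 0
    then show ?case
      by (simp add: chain_prob_def chain_fun_def chain_coeff_def qint_def \<sigma>_def \<tau>_def)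
  next
    case (Suc n)
    define J where "J = (\<integral>s. indicator {q * x<..} s *\<^sub>R (of_real (exp (- s)) * chain_fun n s) \<partial>lborel)"
    note int = chain_fun_Suc(1)[of x n]
    have fS: "chain_fun (Suc n) x = chain_coeff (Suc n) + \<i> * of_real (\<sigma> * \<tau>) * J"
      using chain_fun_Suc(2)[of n x] by (simp only: st J_def)
    have nonneg: "0 \<le> q * x" using q Suc.prems by simp
    have chain_Suc: "chain_prob (Suc n) = transfer_op \<mu> (- q) (chain_prob n)"
      by (simp add: chain_prob_def)
    have Re_J: "(\<integral>s. indicator {q * x<..} s * (exp (- s) * (\<sigma> * chain_prob n s)) \<partial>lborel) = Re J"
    proof -
      have "Re J = (\<integral>s. Re (indicator {q * x<..} s *\<^sub>R (of_real (exp (- s)) * chain_fun n s)) \<partial>lborel)"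
        unfolding J_def using int by (rule integral_Re[symmetric])
      also have "\<dots> = (\<integral>s. indicator {q * x<..} s * (exp (- s) * (\<sigma> * chain_prob n s)) \<partial>lborel)"
        using Suc.IH nonneg by (intro Bochner_Integration.integral_cong) (auto simp: indicator_def)
      finally show ?thesis ..
    qed
    have Im_J: "(\<integral>s. indicator {q * x<..} s * (exp (- s) * (\<tau> * chain_prob n (- s))) \<partial>lborel) = Im J"
    proof -
      have "Im J = (\<integral>s. Im (indicator {q * x<..} s *\<^sub>R (of_real (exp (- s)) * chain_fun n s)) \<partial>lborel)"
        unfolding J_def using int by (rule integral_Im[symmetric])
      also have "\<dots> = (\<integral>s. indicator {q * x<..} s * (exp (- s) * (\<tau> * chain_prob n (- s))) \<partial>lborel)"
        using Suc.IH nonneg by (intro Bochner_Integration.integral_cong) (auto simp: indicator_def)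
      finally show ?thesis ..
    qed
    \<comment> \<open>Of \<open>\<xi> = \<tau> * \<tau>\<close>, one factor goes into the integral,
      where it forms the imaginary part; the other joins \<open>\<sigma>\<close> to give the
      coupling constant \<open>\<sigma> * \<tau>\<close>.\<close>
    have "\<sigma> * chain_prob (Suc n) x = \<sigma> * chain_integral n
        - \<sigma> * \<tau> * (\<tau> * (\<integral>s. indicator {q * x<..} s * (exp (- s) * chain_prob n (- s)) \<partial>lborel))"
      unfolding chain_Suc chain_integral_def
      by (subst transfer_op_nonneg[OF chain_prob_measurable chain_prob_unit Suc.prems])
         (simp add: algebra_simps flip: st(2))
    also have "\<tau> * (\<integral>s. indicator {q * x<..} s * (exp (- s) * chain_prob n (- s)) \<partial>lborel) = Im J"
      unfolding Im_J[symmetric] integral_mult_right_zero[symmetric] by (simp only: mult_ac)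
    also have "\<sigma> * chain_integral n - \<sigma> * \<tau> * Im J = Re (chain_fun (Suc n) x)"
      by (simp add: fS chain_coeff_def \<sigma>_def)
    finally have 1: "\<sigma> * chain_prob (Suc n) x = Re (chain_fun (Suc n) x)" .
    have "\<tau> * chain_prob (Suc n) (- x)
        = \<sigma> * \<tau> * (\<sigma> * (\<integral>s. indicator {q * x<..} s * (exp (- s) * chain_prob n s) \<partial>lborel))"
      unfolding chain_Suc
      by (subst transfer_op_nonpos[OF chain_prob_measurable Suc.prems]) (simp add: algebra_simps flip: st(1))
    also have "\<sigma> * (\<integral>s. indicator {q * x<..} s * (exp (- s) * chain_prob n s) \<partial>lborel) = Re J"
      unfolding Re_J[symmetric] integral_mult_right_zero[symmetric] by (simp only: mult_ac)
    also have "\<sigma> * \<tau> * Re J = Im (chain_fun (Suc n) x)"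
      by (simp add: fS chain_coeff_def)
    finally have 2: "\<tau> * chain_prob (Suc n) (- x) = Im (chain_fun (Suc n) x)" .
    from 1 2 show ?case ..
  qed
  then show "sqrt (1 - \<xi>) * chain_prob n x = Re (chain_fun n x)" "sqrt \<xi> * chain_prob n (- x) = Im (chain_fun n x)"
    by (simp_all add: \<sigma>_def \<tau>_def)
qed

end

section \<open>Summation over the number of steps and elimination at the start
  \<open>0\<close>\<close>

lemma qexp_cauchy_product:
  fixes c z :: complex
  assumes q: "0 < q" and cz: "q < 1 \<Longrightarrow> norm (c * z) < 1 / (1 - q)"
    and d: "summable (\<lambda>n. norm (d n * z ^ n))"
  shows "(\<lambda>n. (\<Sum>k\<le>n. d (n - k) * c ^ k / of_real (qfact q k)) * z ^ n) sums (qexp q (c * z) * (\<Sum>n. d n * z ^ n))"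
proof -
  define b where "b k = (c * z) ^ k / of_real (qfact q k)" for k
  \<comment> \<open>The \<open>q\<close>-factorials are nonnegative, so absolute convergence at
    \<open>c * z\<close> is convergence at the real point \<open>norm (c * z)\<close>.\<close>
  have "summable (\<lambda>k. of_real (norm (c * z)) ^ k / complex_of_real (qfact q k))"
    using cz q summable_qexp_lt1[of q "of_real (norm (c * z))"] summable_qexp_ge1[of q "of_real (norm (c * z))"]
    by (cases "q < 1") auto
  then have "summable (\<lambda>k. norm (c * z) ^ k / qfact q k)"
    by (simp flip: of_real_power of_real_divide add: summable_complex_of_real)
  moreover have "0 \<le> qfact q k" for k
    using q qfact_Suc_qint[OF q] qint_nonneg[OF q] by (induction k) auto
  ultimately have "summable (\<lambda>k. norm (b k))"
    by (simp add: b_def norm_divide norm_power)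
  from Cauchy_product_sums[OF this d]
  have "(\<lambda>n. \<Sum>k\<le>n. b k * (d (n - k) * z ^ (n - k))) sums (suminf b * (\<Sum>n. d n * z ^ n))" .
  moreover have "suminf b = qexp q (c * z)"
    unfolding b_def[abs_def] using qexp_sums[OF q cz] by (simp add: sums_iff)
  moreover have "(\<Sum>k\<le>n. b k * (d (n - k) * z ^ (n - k))) = (\<Sum>k\<le>n. d (n - k) * c ^ k / of_real (qfact q k)) * z ^ n" for n
    unfolding sum_distrib_right
  proof (rule sum.cong[OF refl])
    fix k assume "k \<in> {..n}"
    then have "z ^ n = z ^ k * z ^ (n - k)" by (simp flip: power_add)
    then show "b k * (d (n - k) * z ^ (n - k)) = d (n - k) * c ^ k / of_real (qfact q k) * z ^ n"
      by (simp add: b_def power_mult_distrib)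
  qed
  ultimately show ?thesis by simp
qed

text \<open>At the start \<open>0\<close> both branches give the same probability. This yields one
  equation, linear in the unknown sum. The leading \<open>1\<close> in \<open>a\<close> comes from
  the value at infinity for zero steps.\<close>

lemma generating_function:
  fixes \<xi> q s w :: real and \<mu> :: "real measure" and z :: complex
  assumes xi: "0 < \<xi>" "\<xi> < 1" and q: "0 < q"
    and mu: "\<mu> = laplace_measure \<xi>" and prob: "real_prob_measure \<mu>"
    and s: "s = sqrt ((1 - \<xi>) / \<xi>)" and w: "w = sqrt (\<xi> * (1 - \<xi>))" and z: "norm z < 1"
  defines "a \<equiv> \<lambda>n. case n of 0 \<Rightarrow> 1 | Suc m \<Rightarrow> \<integral>x. (transfer_op \<mu> (- q) ^^ m) (\<lambda>_. 1) x \<partial>\<mu>"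
  shows "summable (\<lambda>n. of_real (a n) * z ^ n)"
    and "(\<Sum>n. of_real (a n) * z ^ n) * (qcos q (of_real w * z) - of_real s * qsin q (of_real w * z))
       = qcos q (of_real w * z) + of_real (1 / s) * qsin q (of_real w * z)"
proof -
  note facts = xi q mu prob
  define \<sigma> \<tau> where "\<sigma> = sqrt (1 - \<xi>)" and "\<tau> = sqrt \<xi>"
  have pos: "0 < \<sigma>" "0 < \<tau>" using xi by (simp_all add: \<sigma>_def \<tau>_def)
  have sw: "s = \<sigma> / \<tau>" "w = \<sigma> * \<tau>"
    using s w by (simp_all add: \<sigma>_def \<tau>_def real_sqrt_mult real_sqrt_divide)
  define d where "d = chain_coeff \<xi> q \<mu>"
  have a_unit: "0 \<le> a n \<and> a n \<le> 1" for n
    using chain_integral_unit[OF facts]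
    by (auto simp: a_def chain_integral_def[OF facts] chain_prob_def[OF facts] split: nat.split)
  have d_eq: "d n = of_real (\<sigma> * a n) + \<i> * of_real (if n = 0 then \<tau> else 0)" for n
    by (simp add: d_def a_def chain_coeff_def[OF facts] chain_integral_def[OF facts]
        chain_prob_def[OF facts] \<sigma>_def \<tau>_def split: nat.split)
  have geo: "summable (\<lambda>n. norm z ^ n)" using z by simp
  have "norm (of_real (a n) * z ^ n) \<le> norm z ^ n" for n
    using a_unit[of n] by (simp add: norm_mult norm_power mult_left_le_one_le)
  then have sa': "summable (\<lambda>n. norm (of_real (a n) * z ^ n))"
    by (intro summable_comparison_test'[OF geo]) simp
  then show sa: "summable (\<lambda>n. of_real (a n) * z ^ n)" by (rule summable_norm_cancel)
  define A where "A = (\<Sum>n. of_real (a n) * z ^ n)"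
  have ee: "(\<lambda>n. e n * z ^ n) sums (of_real \<sigma> * A + c)" "summable (\<lambda>n. norm (e n * z ^ n))"
    if e: "\<And>n. e n = of_real (\<sigma> * a n) + (if n = 0 then c else 0)" for e c
  proof -
    have fin: "(\<lambda>n. (if n = 0 then c else 0) * z ^ n) sums c"
    proof -
      have "(\<lambda>n. (if n = 0 then c else 0) * z ^ n) = (\<lambda>n. if n = 0 then c * z ^ n else 0)" by auto
      then show ?thesis using sums_single[of 0 "\<lambda>n. c * z ^ n"] by simp
    qed
    have "(\<lambda>n. of_real \<sigma> * (of_real (a n) * z ^ n)) sums (of_real \<sigma> * A)"
      unfolding A_def by (intro sums_mult summable_sums sa)
    from sums_add[OF this fin] show "(\<lambda>n. e n * z ^ n) sums (of_real \<sigma> * A + c)"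
      by (simp add: e algebra_simps)
    have "summable (\<lambda>n. norm (of_real \<sigma> * (of_real (a n) * z ^ n)))"
      using summable_mult[OF sa', of \<sigma>] pos by (simp add: norm_mult)
    moreover have "summable (\<lambda>n. norm ((if n = 0 then c else 0) * z ^ n))"
      by (rule summable_finite[of "{0}"]) auto
    ultimately have "summable (\<lambda>n. norm (of_real \<sigma> * (of_real (a n) * z ^ n)) + norm ((if n = 0 then c else 0) * z ^ n))"
      by (rule summable_add)
    then show "summable (\<lambda>n. norm (e n * z ^ n))"
    proof (rule summable_comparison_test'[where N = 0])
      fix n :: nat
      have "e n * z ^ n = of_real \<sigma> * (of_real (a n) * z ^ n) + (if n = 0 then c else 0) * z ^ n"
        by (simp add: e algebra_simps)
      then show "norm (norm (e n * z ^ n)) \<le> norm (of_real \<sigma> * (of_real (a n) * z ^ n)) + norm ((if n = 0 then c else 0) * z ^ n)"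
        by (simp only: real_norm_def abs_norm_cancel norm_triangle_ineq)
    qed
  qed
  \<comment> \<open>For \<open>q < 1\<close> the exponential series is at hand only below
    \<open>1 / (1 - q)\<close>, a number greater than \<open>1\<close>.\<close>
  have wz: "norm (of_real w * z) < 1"
  proof -
    have "\<xi> * (1 - \<xi>) < 1 * 1" using xi by (intro mult_strict_mono) auto
    then have "w < 1" using w by simp
    moreover have "0 < w" using pos sw by simp
    ultimately show ?thesis using z mult_strict_mono[of w 1 "norm z" 1] by (simp add: norm_mult)
  qed
  have small: "norm (c * of_real w * z) < 1 / (1 - q)" if "q < 1" "norm c = 1" for c
  proof -
    have "1 \<le> 1 / (1 - q)" using that q by simp
    moreover have "norm (c * of_real w * z) = norm (of_real w * z)"
      using that by (simp add: norm_mult)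
    ultimately show ?thesis using wz by linarith
  qed
  define f where "f n = (\<Sum>k\<le>n. d (n - k) * (\<i> * of_real w) ^ k / of_real (qfact q k))" for n
  have f: "f n = chain_fun \<xi> q \<mu> n 0" for n
    by (simp add: f_def chain_fun_def[OF facts] d_def w)
  have d1: "d n = of_real (\<sigma> * a n) + (if n = 0 then \<i> * of_real \<tau> else 0)"
    and d2: "cnj (d n) = of_real (\<sigma> * a n) + (if n = 0 then - \<i> * of_real \<tau> else 0)" for n
    by (simp_all add: d_eq)
  have sums1: "(\<lambda>n. f n * z ^ n) sums (qexp q (\<i> * of_real w * z) * (of_real \<sigma> * A + \<i> * of_real \<tau>))"
    using qexp_cauchy_product[OF q small[of \<i>] ee(2)[OF d1]] ee(1)[OF d1]
    by (simp add: f_def sums_iff)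
  \<comment> \<open>Conjugating the coefficients but not \<open>z\<close> gives a second power
    series in the same \<open>z\<close>, so the comparison is valid for complex
    \<open>z\<close>.\<close>
  have cnj_f: "cnj (f n) = (\<Sum>k\<le>n. cnj (d (n - k)) * (- \<i> * of_real w) ^ k / of_real (qfact q k))" for n
    by (simp add: f_def)
  have sums2: "(\<lambda>n. cnj (f n) * z ^ n) sums (qexp q (- \<i> * of_real w * z) * (of_real \<sigma> * A - \<i> * of_real \<tau>))"
    using qexp_cauchy_product[OF q small[of "- \<i>"] ee(2)[OF d2]] ee(1)[OF d2]
    unfolding cnj_f by (simp add: sums_iff)
  \<comment> \<open>Both branches apply at \<open>0\<close>, so \<open>f n\<close> is a real
    multiple of \<open>\<sigma> + \<i> * \<tau>\<close>.\<close>
  have "(of_real \<sigma> - \<i> * of_real \<tau>) * f n = (of_real \<sigma> + \<i> * of_real \<tau>) * cnj (f n)" for n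
  proof -
    have "\<sigma> * chain_prob q \<mu> n 0 = Re (f n)" "\<tau> * chain_prob q \<mu> n 0 = Im (f n)"
      using chain_prob_chain_fun[OF facts, of 0 n] by (simp_all add: f \<sigma>_def \<tau>_def)
    then have "\<tau> * Re (f n) = \<sigma> * Im (f n)" by (metis mult.left_commute)
    then show ?thesis by (simp add: complex_eq_iff algebra_simps)
  qed
  then have fun_eq: "(\<lambda>n. (of_real \<sigma> - \<i> * of_real \<tau>) * (f n * z ^ n)) = (\<lambda>n. (of_real \<sigma> + \<i> * of_real \<tau>) * (cnj (f n) * z ^ n))"
    by (simp add: mult.assoc[symmetric])
  have eq: "(of_real \<sigma> - \<i> * of_real \<tau>) * (qexp q (\<i> * of_real w * z) * (of_real \<sigma> * A + \<i> * of_real \<tau>))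
     = (of_real \<sigma> + \<i> * of_real \<tau>) * (qexp q (- \<i> * of_real w * z) * (of_real \<sigma> * A - \<i> * of_real \<tau>))"
    by (rule sums_unique2[OF sums_mult[OF sums1]]) (unfold fun_eq, rule sums_mult[OF sums2])
  define C S where "C = qcos q (of_real w * z)" and "S = qsin q (of_real w * z)"
  have CS: "qexp q (\<i> * of_real w * z) = C + \<i> * S" "qexp q (- \<i> * of_real w * z) = C - \<i> * S"
    using qexp_qcos_qsin[OF q, of "of_real w * z"] by (simp_all add: C_def S_def mult.assoc)
  have "A * (of_real \<sigma> * of_real \<tau> * C - of_real \<sigma> * of_real \<sigma> * S)
      = of_real \<tau> * of_real \<tau> * S + of_real \<sigma> * of_real \<tau> * C"
  proof -
    define X Y where "X = complex_of_real \<sigma>" and "Y = complex_of_real \<tau>"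
    have "(X - \<i> * Y) * ((C + \<i> * S) * (X * A + \<i> * Y)) - (X + \<i> * Y) * ((C - \<i> * S) * (X * A - \<i> * Y))
        = 2 * \<i> * (Y * Y * S + X * Y * C - A * (X * Y * C - X * X * S))"
      by (simp add: algebra_simps)
    moreover have "(X - \<i> * Y) * ((C + \<i> * S) * (X * A + \<i> * Y)) - (X + \<i> * Y) * ((C - \<i> * S) * (X * A - \<i> * Y)) = 0"
      using eq unfolding CS X_def Y_def by simp
    ultimately show ?thesis by (simp add: X_def Y_def)
  qed
  then show "A * (C - of_real s * S) = C + of_real (1 / s) * S"
    using pos by (simp add: sw field_simps)
qed


section \<open>Asymptotics\<close>

theorem corollary4p13:
  fixes M :: "'a measure" and X :: "nat \<Rightarrow> 'a \<Rightarrow> real"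
    and \<theta> \<xi> \<gamma> u lam z\<^sub>0 :: real
    and h g :: "complex \<Rightarrow> complex" and c c\<^sub>2 :: complex
  assumes "prob_space M"
    and "prob_space.indep_vars M (\<lambda>_. borel) X UNIV"
    and "\<And>i. distributed M lborel (X i) (\<lambda>x. ennreal (laplace_density \<xi> x))"
    and "\<theta> < 0" and "0 < \<xi>" and "\<xi> < 1"
    and "\<gamma> = (1 - \<xi>) / \<xi>"
    and "u = - sqrt (\<xi> * (1 - \<xi>))"
    and "lam = - u / qarctan (- \<theta>) (\<gamma> powr (- 1 / 2))"
    and "z\<^sub>0 = 1 / lam"
    and "g = (\<lambda>z. qcos (- \<theta>) (of_real u * z)
                  + of_real (\<gamma> powr (1 / 2)) * qsin (- \<theta>) (of_real u * z))"
    and "h = (\<lambda>z. qcos (- \<theta>) (of_real u * z)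
                  - of_real (\<gamma> powr (- 1 / 2)) * qsin (- \<theta>) (of_real u * z))"
    and "c = Lim (at (of_real z\<^sub>0)) (\<lambda>z. (of_real z\<^sub>0 - z) * (h z / g z))"
    and "c\<^sub>2 = c * of_real lam"
  shows "((\<lambda>z. (of_real z\<^sub>0 - z) * (h z / g z)) \<longlongrightarrow> c) (at (of_real z\<^sub>0))
    \<and> g field_differentiable at (of_real z\<^sub>0) \<and> deriv g (of_real z\<^sub>0) \<noteq> 0
    \<and> c = - (h (of_real z\<^sub>0) / deriv g (of_real z\<^sub>0))
    \<and> (\<lambda>n. complex_of_real (persistence M X \<theta> n) / (c\<^sub>2 * of_real lam ^ (n + 1))) \<longlonglongrightarrow> 1"
proof -
  \<comment> \<open>Cosine is even and sine odd, so passing from the negative \<open>u\<close> to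
    \<open>w\<close> gives the signs of \<open>generating_function\<close>.\<close>
  define q w s where "q = - \<theta>" and "w = - u" and "s = sqrt \<gamma>"
  define \<mu> where "\<mu> = laplace_measure \<xi>"
  note xi = assms(5,6)
  have q: "0 < q" using assms(4) by (simp add: q_def)
  have w: "w = sqrt (\<xi> * (1 - \<xi>))" "0 < w" using assms(8) xi by (simp_all add: w_def)
  have \<gamma>: "0 < \<gamma>" using assms(7) xi by simp
  have s: "s = sqrt ((1 - \<xi>) / \<xi>)" "0 < s" using assms(7) \<gamma> by (simp_all add: s_def)
  have s_powr: "\<gamma> powr (1 / 2) = s" "\<gamma> powr (- 1 / 2) = 1 / s"
    using \<gamma> powr_minus_divide[of \<gamma> "1 / 2"] by (simp_all add: s_def powr_half_sqrt)

  interpret M: prob_space M by (rule assms(1))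
  have distr: "distr M borel (X i) = \<mu>" for i
  proof -
    have "distr M borel (X i) = distr M lborel (X i)" by (intro distr_cong) auto
    also have "\<dots> = \<mu>"
      using distributed_distr_eq_density[OF assms(3)[of i]] by (simp add: \<mu>_def laplace_measure_def)
    finally show ?thesis .
  qed
  have "X 0 \<in> borel_measurable M"
    using assms(2) by (simp add: M.indep_vars_def)
  then have "prob_space \<mu>"
    using M.prob_space_distr distr[of 0] by metis
  then have prob: "real_prob_measure \<mu>"
    by (simp add: real_prob_measure_def real_prob_measure_axioms_def \<mu>_def laplace_measure_def)
  have pers: "persistence M X \<theta> n = (\<integral>x. (transfer_op \<mu> (- q) ^^ n) (\<lambda>_. 1) x \<partial>\<mu>)" for n
    using persistence_eq_integral[OF assms(1,2) prob distr, of \<theta> n] by (simp add: q_def)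
  define a where "a = (\<lambda>n. case n of 0 \<Rightarrow> 1 | Suc m \<Rightarrow> persistence M X \<theta> m)"

  define Q where "Q = max q (1 / q)"
  have Q: "1 \<le> Q"
    using q by (cases "1 \<le> q") (simp_all add: Q_def le_max_iff_disj)
  define \<alpha> where "\<alpha> = qarctan Q (1 / s)"
  have \<alpha>: "0 < \<alpha>" "\<alpha> < qcos_zero Q" "rsin Q \<alpha> = 1 / s * rcos Q \<alpha>"
    unfolding \<alpha>_def using Q s(2) by (intro qarctan_pos qarctan_less qarctan_eq; simp)+
  have lam: "lam = w / \<alpha>"
    using assms(9) qarctan_dual[OF q, of "1 / s"] by (simp only: s_powr \<alpha>_def Q_def w_def flip: q_def)
  have z0: "z\<^sub>0 = \<alpha> / w" "0 < z\<^sub>0" "w * z\<^sub>0 = \<alpha>" "z\<^sub>0 * lam = 1"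
    using assms(10) lam \<alpha>(1) w(2) by simp_all

  define G H where "G = (\<lambda>z. qcos Q (of_real w * z) - of_real s * qsin Q (of_real w * z))"
    and "H = (\<lambda>z. qcos Q (of_real w * z) + of_real (1 / s) * qsin Q (of_real w * z))"
  define k where "k z = qdual q (of_real w * z)" for z
  have u: "of_real u * z = - (of_real w * z)" for z :: complex by (simp add: w_def)
  have g: "g z = qcos q (of_real w * z) - of_real s * qsin q (of_real w * z)"
    and h: "h z = qcos q (of_real w * z) + of_real (1 / s) * qsin q (of_real w * z)" for z
    unfolding assms(11,12) u s_powr q_def[symmetric] qcos_minus[OF q] qsin_minus[OF q] by simp_all
  \<comment> \<open>The half-plane contains a neighbourhood of \<open>z\<^sub>0\<close> and serves
    the limit and the derivative; the unit disc is where the power series is known.\<close>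
  have dual: "g z = k z * G z" "h z = k z * H z" "k z \<noteq> 0" if "0 < Re z \<or> norm z < 1" for z
  proof -
    have "Re (of_real w * z) \<noteq> 0 \<or> norm (of_real w * z) * (1 - q) < 1"
    proof (cases "0 < Re z")
      case False
      have "\<xi> * (1 - \<xi>) < 1 * 1" using xi by (intro mult_strict_mono) auto
      then have "w < 1" using w by simp
      then have "norm (of_real w * z) < 1"
        using False that w(2) mult_strict_mono[of w 1 "norm z" 1] by (simp add: norm_mult)
      moreover have "norm (of_real w * z) * (1 - q) \<le> norm (of_real w * z)"
        using q by (intro mult_left_le) auto
      ultimately show ?thesis by linarith
    qed (use w(2) in simp)
    note d = qcos_dual[OF q this] qsin_dual[OF q this] qdual_nonzero[OF q this]
    show "g z = k z * G z" "h z = k z * H z" "k z \<noteq> 0"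
      using d(3) unfolding g h d(1,2) by (simp_all add: k_def G_def H_def Q_def algebra_simps)
  qed

  have holG: "G holomorphic_on A" and holH: "H holomorphic_on A" for A
    unfolding G_def H_def using Q by (intro holomorphic_intros; simp)+
  define F where "F = (\<lambda>z. qcos Q z - of_real s * qsin Q z)"
  have w_z0: "of_real w * complex_of_real z\<^sub>0 = of_real \<alpha>"
    by (simp only: z0(3) flip: of_real_mult)
  have rc: "rcos Q \<alpha> = s * rsin Q \<alpha>" using \<alpha>(3) s(2) by simp
  have G0: "G (of_real z\<^sub>0) = 0"
    using rc by (simp add: G_def w_z0 qcos_of_real[OF Q] qsin_of_real[OF Q])
  have "F holomorphic_on UNIV"
    unfolding F_def using Q by (intro holomorphic_intros; simp)
  then have "(F has_field_derivative deriv F (of_real w * of_real z\<^sub>0)) (at (of_real w * of_real z\<^sub>0))"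
    by (rule holomorphic_derivI) auto
  then have "((\<lambda>z. F (of_real w * z)) has_field_derivative deriv F (of_real w * of_real z\<^sub>0) * of_real w) (at (of_real z\<^sub>0))"
    by (rule DERIV_chain2) (auto intro!: derivative_eq_intros)
  then have "deriv G (of_real z\<^sub>0) = deriv F (of_real \<alpha>) * of_real w"
    by (intro DERIV_imp_deriv) (simp add: F_def G_def w_z0)
  then have dG: "deriv G (of_real z\<^sub>0) \<noteq> 0"
    using deriv_qcos_diff_qsin_nonzero[OF Q s(2) rc] w(2) by (simp add: F_def)
  have Gd: "(G has_field_derivative deriv G (of_real z\<^sub>0)) (at (of_real z\<^sub>0))"
    using holomorphic_derivI[OF holG open_UNIV] by blast
  \<comment> \<open>Cosine and sine are both positive at \<open>\<alpha>\<close>. This makes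
    \<open>c\<close> nonzero, so that the quotient by \<open>c\<^sub>2 * lam ^ (n + 1)\<close> is a
    genuine one.\<close>
  have H0: "H (of_real z\<^sub>0) \<noteq> 0"
  proof -
    have "0 < rcos Q \<alpha>" using \<alpha> by (intro rcos_pos[OF Q]) simp
    moreover from this have "0 < rsin Q \<alpha>" using \<alpha>(3) s(2) by simp
    ultimately have "0 < rcos Q \<alpha> + 1 / s * rsin Q \<alpha>" using s(2) by (intro add_pos_pos) simp_all
    moreover have "H (of_real z\<^sub>0) = of_real (rcos Q \<alpha> + 1 / s * rsin Q \<alpha>)"
      by (simp add: H_def w_z0 qcos_of_real[OF Q] qsin_of_real[OF Q])
    ultimately show ?thesis by (simp only: of_real_eq_0_iff)
  qed

  have re: "open {z. 0 < Re z}" "complex_of_real z\<^sub>0 \<in> {z. 0 < Re z}"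
    using z0(2) by (simp_all add: open_halfspace_Re_gt)
  have "qdual q field_differentiable at (of_real w * of_real z\<^sub>0)"
    using qdual_differentiable[OF q, of "of_real \<alpha>"] \<alpha>(1) by (simp add: w_z0)
  then obtain k' where "(qdual q has_field_derivative k') (at (of_real w * of_real z\<^sub>0))"
    by (auto simp: field_differentiable_def)
  then have "(k has_field_derivative k' * of_real w) (at (of_real z\<^sub>0))"
    unfolding k_def[abs_def] by (rule DERIV_chain2) (auto intro!: derivative_eq_intros)
  \<comment> \<open>The term with the derivative of \<open>k\<close> drops out because
    \<open>G\<close> vanishes at \<open>z\<^sub>0\<close>.\<close>
  from DERIV_mult[OF this Gd]
  have "((\<lambda>z. k z * G z) has_field_derivative k (of_real z\<^sub>0) * deriv G (of_real z\<^sub>0)) (at (of_real z\<^sub>0))"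
    by (simp add: G0 mult.commute)
  then have gd: "(g has_field_derivative k (of_real z\<^sub>0) * deriv G (of_real z\<^sub>0)) (at (of_real z\<^sub>0))"
    by (rule has_field_derivative_transform_within_open[OF _ re]) (simp add: dual)
  note k0 = dual[OF disjI1, of "of_real z\<^sub>0"]

  define c' where "c' = - (H (of_real z\<^sub>0) / deriv G (of_real z\<^sub>0))"
  have "isCont H (of_real z\<^sub>0)"
    using holomorphic_on_imp_continuous_on[OF holH[of UNIV]] by (simp add: continuous_on_eq_continuous_at)
  from simple_zero_quotient_tendsto[OF Gd G0 dG this]
  have "((\<lambda>z. (of_real z\<^sub>0 - z) * (H z / G z)) \<longlongrightarrow> c') (at (of_real z\<^sub>0))"
    unfolding c'_def .
  moreover have "\<forall>\<^sub>F z in at (of_real z\<^sub>0). (of_real z\<^sub>0 - z) * (H z / G z) = (of_real z\<^sub>0 - z) * (h z / g z)"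
    using eventually_at_in_open'[OF re] by eventually_elim (simp add: dual)
  ultimately have lim: "((\<lambda>z. (of_real z\<^sub>0 - z) * (h z / g z)) \<longlongrightarrow> c') (at (of_real z\<^sub>0))"
    using tendsto_cong by fast
  then have c: "c = c'" unfolding assms(13) by (intro tendsto_Lim) simp_all
  have c0: "c \<noteq> 0" unfolding c c'_def using H0 dG by simp

  have gf: "summable (\<lambda>n. of_real (a n) * z ^ n)"
      "(\<Sum>n. of_real (a n) * z ^ n) * G z = H z" if "norm z < 1" for z
    using generating_function[OF xi q \<mu>_def prob s(1) w(1) that] dual[of z] that
    unfolding a_def pers g[symmetric] h[symmetric] by (simp_all add: mult.left_commute)
  have "(\<lambda>n. of_real (a n) * of_real z\<^sub>0 ^ Suc n) \<longlonglongrightarrow> c"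
    unfolding c c'_def
  \<comment> \<open>Multiplication by \<open>w\<close> maps this ball onto the disc of
    \<open>qcos_eq_qsin_unique\<close>; \<open>r = 1\<close> is the range of
    \<open>generating_function\<close>.\<close>
  proof (rule simple_pole_coeff_asymptotics[where \<rho> = "qcos_zero Q / w" and r = 1])
    show "complex_of_real z\<^sub>0 \<in> ball 0 (qcos_zero Q / w)"
    proof -
      have "z\<^sub>0 < qcos_zero Q / w"
        unfolding z0(1) using \<alpha>(2) w(2) by (rule divide_strict_right_mono)
      then show ?thesis using z0(2) by simp
    qed
    fix z :: complex assume z: "z \<in> ball 0 (qcos_zero Q / w)" "G z = 0"
    have "of_real w * z = of_real \<alpha>"
      unfolding \<alpha>_def
    proof (rule qcos_eq_qsin_unique[OF Q s(2)])
      show "qcos Q (of_real w * z) = of_real s * qsin Q (of_real w * z)"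
        using z(2) by (simp add: G_def)
      show "norm (of_real w * z) < qcos_zero Q"
        using z(1) w(2) by (simp add: norm_mult pos_less_divide_eq mult.commute)
    qed
    then show "z = of_real z\<^sub>0" using w(2) by (simp add: z0(1) field_simps)
  qed (use holG holH G0 dG gf in \<open>auto simp: sums_iff\<close>)
  \<comment> \<open>The shift in \<open>a\<close> turns the exponent for
    \<open>persistence M X \<theta> n\<close> into \<open>n + 2\<close>; the extra power is the
    factor \<open>lam\<close> in \<open>c\<^sub>2\<close>.\<close>
  then have "(\<lambda>n. of_real (a (Suc n)) * of_real z\<^sub>0 ^ Suc (Suc n)) \<longlonglongrightarrow> c"
    by (rule LIMSEQ_Suc)
  then have "(\<lambda>n. of_real (a (Suc n)) * of_real z\<^sub>0 ^ Suc (Suc n) / c) \<longlonglongrightarrow> c / c"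
    using c0 by (intro tendsto_divide) auto
  moreover have "of_real (a (Suc n)) * of_real z\<^sub>0 ^ Suc (Suc n) / c
      = complex_of_real (persistence M X \<theta> n) / (c\<^sub>2 * of_real lam ^ (n + 1))" for n
  proof -
    have "z\<^sub>0 = 1 / lam" "lam \<noteq> 0" using assms(10) z0(4) by auto
    then show ?thesis
      using c0 by (simp add: a_def assms(14) power_divide mult_ac)
  qed
  ultimately have "(\<lambda>n. complex_of_real (persistence M X \<theta> n) / (c\<^sub>2 * of_real lam ^ (n + 1))) \<longlonglongrightarrow> 1"
    using c0 by simp
  moreover have "g field_differentiable at (of_real z\<^sub>0)"
    using gd by (auto simp: field_differentiable_def)
  moreover have "deriv g (of_real z\<^sub>0) = k (of_real z\<^sub>0) * deriv G (of_real z\<^sub>0)"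
    using gd by (rule DERIV_imp_deriv)
  moreover from this have "deriv g (of_real z\<^sub>0) \<noteq> 0" "c = - (h (of_real z\<^sub>0) / deriv g (of_real z\<^sub>0))"
    using k0 z0(2) dG by (simp_all add: c c'_def)
  ultimately show ?thesis using lim c by blast
qed

end
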